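(* Let $h_\infty>0$ and consider the linear boundary value problem $$p_t=p_{xx}+p,\quad 0<x<h_\infty,\qquad p_x(t,0)=0,\quad p(t,h_\infty)=0,$$ which is the linearization about $u=0$ of $u_t=u_{xx}+u(1-u)$, $u_x(t,0)=0$, $u(t,h_\infty)=0$. The associated operator $L=\partial_{xx}+1$ on $L^2((0,h_\infty))$ with boundary conditions $p'(0)=p(h_\infty)=0$ has spectrum consisting exactly of the simple eigenvalues $$\lambda_n=1-\frac{(n-\tfrac12)^2\pi^2}{h_\infty^2},\qquad n\ge 1,\ n\in\mathbb{Z},$$ with eigenfunctions $\phi_n(x)=\cos\!\left(\frac{(2n-1)\pi x}{2h_\infty}\right)$. In particular, the zero solution is spectrally stable if $h_\infty\le \pi/2$, and spectrally unstable if $h_\infty>\pi/2$.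
   Context: The domain of $L$ is $\{p\in H^2((0,h_\infty)): p'(0)=0,\ p(h_\infty)=0\}$. The zero solution is called spectrally stable if the spectrum of $L$ contains no $\lambda$ with $\operatorname{Re}\lambda>0$, and spectrally unstable otherwise. *)

theory Defs
  imports "HOL-Analysis.Analysis"
begin

section \<open>The Hilbert space of square-integrable functions on an open interval\<close>

text \<open>
  The elements of $L^2((0,h))$ are represented by functions on the line, only the values on
  $(0,h)$ being relevant; equality in $L^2((0,h))$ is the relation \<open>eq_L2\<close>.
  The space is complex, as is needed to speak about the spectrum.
\<close>

definition L2 :: "real \<Rightarrow> (real \<Rightarrow> complex) set" where
  "L2 h = {f. f \<in> borel_measurable (lebesgue_on {0<..<h}) \<and>
              integrable (lebesgue_on {0<..<h}) (\<lambda>x. (cmod (f x))\<^sup>2)}"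

definition eq_L2 :: "real \<Rightarrow> (real \<Rightarrow> complex) \<Rightarrow> (real \<Rightarrow> complex) \<Rightarrow> bool" where
  "eq_L2 h f g \<longleftrightarrow> (AE x in lebesgue_on {0<..<h}. f x = g x)"

definition norm_L2 :: "real \<Rightarrow> (real \<Rightarrow> complex) \<Rightarrow> real" where
  "norm_L2 h f = sqrt (LINT x|lebesgue_on {0<..<h}. (cmod (f x))\<^sup>2)"


section \<open>Weak derivatives and Sobolev spaces\<close>

definition test_function :: "real \<Rightarrow> (real \<Rightarrow> real) \<Rightarrow> bool" where
  "test_function h \<phi> \<longleftrightarrow>
     (\<forall>k x. ((deriv ^^ k) \<phi>) field_differentiable (at x)) \<and>
     compact (closure {x. \<phi> x \<noteq> 0}) \<and> closure {x. \<phi> x \<noteq> 0} \<subseteq> {0<..<h}"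

definition has_weak_deriv :: "real \<Rightarrow> (real \<Rightarrow> complex) \<Rightarrow> (real \<Rightarrow> complex) \<Rightarrow> bool" where
  "has_weak_deriv h f g \<longleftrightarrow>
     (\<forall>\<phi>. test_function h \<phi> \<longrightarrow>
        (LINT x|lebesgue_on {0<..<h}. f x * of_real (deriv \<phi> x)) =
        - (LINT x|lebesgue_on {0<..<h}. g x * of_real (\<phi> x)))"

definition H1 :: "real \<Rightarrow> (real \<Rightarrow> complex) set" where
  "H1 h = {f \<in> L2 h. \<exists>g\<in>L2 h. has_weak_deriv h f g}"

text \<open>
  The weak derivative is unique only up to \<open>eq_L2\<close>; \<open>weak_deriv\<close> picks a representative.
  It is meaningful on \<open>H1 h\<close> only.
\<close>

definition weak_deriv :: "real \<Rightarrow> (real \<Rightarrow> complex) \<Rightarrow> (real \<Rightarrow> complex)" where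
  "weak_deriv h f = (SOME g. g \<in> L2 h \<and> has_weak_deriv h f g)"

definition H2 :: "real \<Rightarrow> (real \<Rightarrow> complex) set" where
  "H2 h = {f \<in> H1 h. weak_deriv h f \<in> H1 h}"

definition norm_H2 :: "real \<Rightarrow> (real \<Rightarrow> complex) \<Rightarrow> real" where
  "norm_H2 h f =
     sqrt ((norm_L2 h f)\<^sup>2 + (norm_L2 h (weak_deriv h f))\<^sup>2
           + (norm_L2 h (weak_deriv h (weak_deriv h f)))\<^sup>2)"

text \<open>
  Boundary values are those of the representative that is continuous on the closed interval.
\<close>

definition has_boundary_value :: "real \<Rightarrow> (real \<Rightarrow> complex) \<Rightarrow> real \<Rightarrow> complex \<Rightarrow> bool" where
  "has_boundary_value h f a c \<longleftrightarrow>
     (\<exists>g. continuous_on {0..h} g \<and> eq_L2 h f g \<and> g a = c)"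


section \<open>Spectral theory of an unbounded operator with domain \<open>D\<close>\<close>

type_synonym operator = "(real \<Rightarrow> complex) \<Rightarrow> (real \<Rightarrow> complex)"

definition shift_op :: "operator \<Rightarrow> complex \<Rightarrow> operator" where
  "shift_op A l = (\<lambda>p x. A p x - l * p x)"

text \<open>
  A number is in the resolvent set if the shifted operator is a bijection from the domain onto
  $L^2((0,h))$, with bounded inverse.
\<close>

definition resolvent_set :: "real \<Rightarrow> (real \<Rightarrow> complex) set \<Rightarrow> operator \<Rightarrow> complex set" where
  "resolvent_set h D A = {l.
     (\<forall>p\<in>D. \<forall>q\<in>D. eq_L2 h (shift_op A l p) (shift_op A l q) \<longrightarrow> eq_L2 h p q) \<and>
     (\<forall>f\<in>L2 h. \<exists>p\<in>D. eq_L2 h (shift_op A l p) f) \<and>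
     (\<exists>C. \<forall>p\<in>D. norm_L2 h p \<le> C * norm_L2 h (shift_op A l p))}"

definition spectrum :: "real \<Rightarrow> (real \<Rightarrow> complex) set \<Rightarrow> operator \<Rightarrow> complex set" where
  "spectrum h D A = - resolvent_set h D A"

definition eigenfunction ::
    "real \<Rightarrow> (real \<Rightarrow> complex) set \<Rightarrow> operator \<Rightarrow> complex \<Rightarrow> (real \<Rightarrow> complex) \<Rightarrow> bool" where
  "eigenfunction h D A l p \<longleftrightarrow>
     p \<in> D \<and> \<not> eq_L2 h p (\<lambda>x. 0) \<and> eq_L2 h (A p) (\<lambda>x. l * p x)"

text \<open>The kernel of the $k$-th power of the shifted operator, on its natural domain.\<close>

primrec kernel_power ::
    "real \<Rightarrow> (real \<Rightarrow> complex) set \<Rightarrow> operator \<Rightarrow> complex \<Rightarrow> nat \<Rightarrow> (real \<Rightarrow> complex) set" where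
  "kernel_power h D A l 0 = {p \<in> L2 h. eq_L2 h p (\<lambda>x. 0)}"
| "kernel_power h D A l (Suc k) = {p \<in> D. shift_op A l p \<in> kernel_power h D A l k}"

text \<open>
  Simplicity is understood algebraically: the generalized eigenspace is one-dimensional.
  The case $k = 1$ says that the eigenspace is one-dimensional.
\<close>

definition simple_eigenvalue ::
    "real \<Rightarrow> (real \<Rightarrow> complex) set \<Rightarrow> operator \<Rightarrow> complex \<Rightarrow> bool" where
  "simple_eigenvalue h D A l \<longleftrightarrow>
     (\<exists>e. eigenfunction h D A l e \<and>
        (\<forall>k\<ge>1. kernel_power h D A l k = {p \<in> L2 h. \<exists>c. eq_L2 h p (\<lambda>x. c * e x)}))"

definition spectrally_stable :: "real \<Rightarrow> (real \<Rightarrow> complex) set \<Rightarrow> operator \<Rightarrow> bool" where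
  "spectrally_stable h D A \<longleftrightarrow> \<not> (\<exists>l\<in>spectrum h D A. Re l > 0)"

definition spectrally_unstable :: "real \<Rightarrow> (real \<Rightarrow> complex) set \<Rightarrow> operator \<Rightarrow> bool" where
  "spectrally_unstable h D A \<longleftrightarrow> \<not> spectrally_stable h D A"


section \<open>The boundary value problem\<close>

definition dom_L :: "real \<Rightarrow> (real \<Rightarrow> complex) set" where
  "dom_L h = {p \<in> H2 h. has_boundary_value h (weak_deriv h p) 0 0 \<and> has_boundary_value h p h 0}"

definition op_L :: "real \<Rightarrow> operator" where
  "op_L h p = (\<lambda>x. weak_deriv h (weak_deriv h p) x + p x)"

text \<open>The right-hand side of the nonlinear equation.\<close>

definition op_N :: "real \<Rightarrow> operator" where
  "op_N h u = (\<lambda>x. weak_deriv h (weak_deriv h u) x + u x * (1 - u x))"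

text \<open>
  \<open>A\<close> is the linearization of \<open>N\<close> about the equilibrium $0$: it is the Frechet derivative at $0$
  of \<open>N\<close>, as a map from \<open>D\<close> with the $H^2$ norm to $L^2((0,h))$.
\<close>

definition linearization_at_zero ::
    "real \<Rightarrow> (real \<Rightarrow> complex) set \<Rightarrow> operator \<Rightarrow> operator \<Rightarrow> bool" where
  "linearization_at_zero h D N A \<longleftrightarrow>
     (\<lambda>x. 0) \<in> D \<and> eq_L2 h (N (\<lambda>x. 0)) (\<lambda>x. 0) \<and>
     (\<forall>p\<in>D. N p \<in> L2 h \<and> A p \<in> L2 h) \<and>
     (\<forall>p\<in>D. \<forall>q\<in>D. \<forall>a b.
        (\<lambda>x. a * p x + b * q x) \<in> D \<and>
        eq_L2 h (A (\<lambda>x. a * p x + b * q x)) (\<lambda>x. a * A p x + b * A q x)) \<and>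
     (\<exists>C. \<forall>p\<in>D. norm_L2 h (A p) \<le> C * norm_H2 h p) \<and>
     (\<forall>\<epsilon>>0. \<exists>\<delta>>0. \<forall>p\<in>D. norm_H2 h p < \<delta> \<longrightarrow>
        norm_L2 h (\<lambda>x. N p x - N (\<lambda>y. 0) x - A p x) \<le> \<epsilon> * norm_H2 h p)"

definition eigval :: "real \<Rightarrow> nat \<Rightarrow> real" where
  "eigval h n = 1 - (real n - 1/2)\<^sup>2 * pi\<^sup>2 / h\<^sup>2"

definition eigfun :: "real \<Rightarrow> nat \<Rightarrow> real \<Rightarrow> complex" where
  "eigfun h n x = complex_of_real (cos ((2 * real n - 1) * pi * x / (2 * h)))"

end

theory Submission
  imports Defs
begin

text \<open>
  Once the functions involved are replaced by their continuous representatives, the spectral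
  problem is a second-order equation that can be solved in closed form. Given a complex $\lambda$,
  choose $w$ with $w^2 = 1 - \lambda$ and let $C(x) = \cos(wx)$ and $S(x) = \sin(wx)/w$
  ($S(x) = x$ if $w = 0$), so that $C' = -w^2 S$, $S' = C$ and $C^2 + w^2 S^2 = 1$. Variation of
  constants (lemma \<open>variation_of_constants\<close>) shows that $p'' + w^2 p = f$ and $p'(0) = 0$ force
  \[ p(x) = p(0)\, C(x) + S(x) \int_0^x C f - C(x) \int_0^x S f . \]
  If $C(h) \neq 0$, the condition $p(h) = 0$ determines $p(0)$, which gives existence, uniqueness
  and a bound by the $L^1$ norm of $f$: the number $\lambda$ is in the resolvent set
  (\<open>in_resolvent_set\<close>). If $C(h) = 0$, then $C$ itself is an eigenfunction. Thus the spectrum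
  is the set of $1 - w^2$ with $\cos(wh) = 0$, which is the asserted list, and stability amounts to
  the sign of the largest eigenvalue.

  The formula also gives algebraic simplicity (\<open>simple_eigenvalue_cos_sol\<close>). With $f = 0$ it says
  that the eigenspace is spanned by $C$. If $(L - \lambda) p = c\, C$, then evaluating it at $h$ yields
  $c\, S(h) \int_0^h C^2 = 0$; here $S(h) \neq 0$ because $w^2 S(h)^2 = 1$, and
  $\int_0^h C^2 = h/2$ because $(SC)' = 2C^2 - 1$. Hence $c = 0$, and no Jordan chain starts.

  The passage from weak derivatives to the equation rests on two facts. A function with a weak
  derivative $g$ in $L^2$ is almost everywhere a constant plus the integral of $g$
  (\<open>weak_imp_ac_representative\<close>, the lemma of du Bois-Reymond, which needs a supply of smooth
  functions with compact support). Conversely, an integral of $g$ has weak derivative $g$, because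
  the product rule holds for an absolutely continuous and a continuously differentiable
  function (\<open>has_ac_deriv_mult_C1\<close>).

  Finally, the remainder of the nonlinear operator at $0$ is $-p^2$. On the domain of $L$ the
  supremum of $|p|$ is at most $\sqrt{h}$ times the $H^2$ norm, since $p(h) = 0$; so the remainder
  is quadratically small (\<open>linearization_op_L\<close>).
\<close>

section \<open>Smooth functions with compact support\<close>

text \<open>
  Differentiability of order $n$ in the recursive form that makes the closure properties plain
  inductions; \<open>smooth_iff_differentiable_times\<close> links it to the iterated \<open>deriv\<close>.
\<close>

primrec differentiable_times :: "nat \<Rightarrow> (real \<Rightarrow> real) \<Rightarrow> bool" where
  "differentiable_times 0 f = True"
| "differentiable_times (Suc n) f =
     (\<exists>f'. (\<forall>x. (f has_real_derivative f' x) (at x)) \<and> differentiable_times n f')"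

lemma differentiable_times_SucI:
  "(\<And>x. (f has_real_derivative f' x) (at x)) \<Longrightarrow> differentiable_times n f' \<Longrightarrow>
    differentiable_times (Suc n) f"
  by auto

lemma differentiable_times_Suc_imp: "differentiable_times (Suc n) f \<Longrightarrow> differentiable_times n f"
  by (induction n arbitrary: f) auto

lemma differentiable_times_const: "differentiable_times n (\<lambda>x. c)"
proof (induction n arbitrary: c)
  case (Suc n)
  then show ?case by (auto intro!: exI[of _ "\<lambda>x. 0"])
qed simp

lemma differentiable_times_add:
  "differentiable_times n f \<Longrightarrow> differentiable_times n g \<Longrightarrow> differentiable_times n (\<lambda>x. f x + g x)"
proof (induction n arbitrary: f g)
  case (Suc n)
  then obtain f' g' where
    "\<forall>x. (f has_real_derivative f' x) (at x)" "differentiable_times n f'"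
    "\<forall>x. (g has_real_derivative g' x) (at x)" "differentiable_times n g'"
    by auto
  then show ?case
    using Suc.IH by (auto intro!: exI[of _ "\<lambda>x. f' x + g' x"] derivative_eq_intros)
qed simp

lemma differentiable_times_mult:
  "differentiable_times n f \<Longrightarrow> differentiable_times n g \<Longrightarrow> differentiable_times n (\<lambda>x. f x * g x)"
proof (induction n arbitrary: f g)
  case (Suc n)
  obtain f' g' where d:
    "\<And>x. (f has_real_derivative f' x) (at x)" "differentiable_times n f'"
    "\<And>x. (g has_real_derivative g' x) (at x)" "differentiable_times n g'"
    using Suc.prems by auto
  have "((\<lambda>x. f x * g x) has_real_derivative (f' x * g x + f x * g' x)) (at x)" for x
    using DERIV_mult'[OF d(1) d(3)] by (simp add: algebra_simps)
  moreover have "differentiable_times n (\<lambda>x. f' x * g x + f x * g' x)"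
    by (intro differentiable_times_add Suc.IH d Suc.prems[THEN differentiable_times_Suc_imp])
  ultimately show ?case by (rule differentiable_times_SucI)
qed simp

lemma differentiable_times_affine:
  "differentiable_times n f \<Longrightarrow> differentiable_times n (\<lambda>x. f (c * x + d))"
proof (induction n arbitrary: f)
  case (Suc n)
  then obtain f' where f': "\<And>x. (f has_real_derivative f' x) (at x)" "differentiable_times n f'"
    by auto
  have "((\<lambda>x. f (c * x + d)) has_real_derivative c * f' (c * x + d)) (at x)" for x
    using DERIV_chain2[OF f'(1), of "\<lambda>x. c * x + d" c x UNIV]
      DERIV_add[OF DERIV_cmult_Id[of c x UNIV] DERIV_const[of d]]
    by (simp add: mult.commute)
  moreover have "differentiable_times n (\<lambda>x. c * f' (c * x + d))"
    by (intro differentiable_times_mult differentiable_times_const Suc.IH f')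
  ultimately show ?case by (rule differentiable_times_SucI)
qed simp

lemma smooth_iff_differentiable_times:
  "(\<forall>k x. ((deriv ^^ k) f) field_differentiable (at x)) \<longleftrightarrow> (\<forall>n. differentiable_times n f)"
proof
  have "differentiable_times n f"
    if "\<forall>k x. ((deriv ^^ k) f) field_differentiable (at x)" for n
    using that
  proof (induction n arbitrary: f)
    case (Suc n)
    have "(f has_real_derivative deriv f x) (at x)" for x
      using Suc.prems[rule_format, of 0 x] by (simp add: field_differentiable_derivI)
    moreover have "\<forall>k x. ((deriv ^^ k) (deriv f)) field_differentiable (at x)"
      using Suc.prems by (metis comp_apply funpow_Suc_right)
    ultimately show ?case using Suc.IH[of "deriv f"] by (simp only: differentiable_times.simps) blast
  qed simp
  then show "\<forall>k x. ((deriv ^^ k) f) field_differentiable (at x) \<Longrightarrow> \<forall>n. differentiable_times n f"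
    by blast
next
  have "((deriv ^^ k) f) field_differentiable (at x)" if "differentiable_times (Suc k) f" for k x
    using that
  proof (induction k arbitrary: f)
    case 0
    then show ?case by (auto simp: field_differentiable_def)
  next
    case (Suc k)
    then obtain f' where f': "\<forall>x. (f has_real_derivative f' x) (at x)" "differentiable_times (Suc k) f'"
      by auto
    then have "f' = deriv f" by (auto intro!: ext DERIV_imp_deriv[symmetric])
    then show ?case using Suc.IH[OF f'(2)] by (simp only: funpow_Suc_right comp_apply)
  qed
  then show "\<forall>n. differentiable_times n f \<Longrightarrow> \<forall>k x. ((deriv ^^ k) f) field_differentiable (at x)"
    by blast
qed

lemma poly_times_exp_tendsto_0:
  "((\<lambda>y::real. poly p y * exp (- y)) \<longlongrightarrow> 0) at_top"
proof -
  have "((\<lambda>y::real. \<Sum>i\<le>degree p. coeff p i * (y ^ i / exp y)) \<longlongrightarrow> (\<Sum>i\<le>degree p. coeff p i * 0)) at_top"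
    by (intro tendsto_sum tendsto_mult tendsto_const tendsto_power_div_exp_0)
  moreover have "(\<lambda>y::real. poly p y * exp (- y)) = (\<lambda>y. \<Sum>i\<le>degree p. coeff p i * (y ^ i / exp y))"
    by (auto simp: poly_altdef sum_distrib_right exp_minus divide_inverse mult.assoc intro!: sum.cong)
  ultimately show ?thesis by simp
qed

text \<open>
  The functions $P(1/x)\, e^{-1/x}$ for $x > 0$, continued by $0$. Allowing a polynomial factor makes
  the family closed under differentiation, so that smoothness is an induction over the order; the
  case $P = 1$ is the standard building block of functions with compact support.
\<close>

definition flat_exp :: "real poly \<Rightarrow> real \<Rightarrow> real" where
  "flat_exp p x = (if x > 0 then poly p (1 / x) * exp (- 1 / x) else 0)"

lemma flat_exp_has_derivative:
  "(flat_exp p has_real_derivative flat_exp ([:0, 0, 1:] * (p - pderiv p)) x) (at x)"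
proof -
  consider "x > 0" | "x < 0" | "x = 0" by linarith
  then show ?thesis
  proof cases
    case 1
    have "((\<lambda>x. poly p (1 / x) * exp (- 1 / x)) has_real_derivative
        flat_exp ([:0, 0, 1:] * (p - pderiv p)) x) (at x)"
      using 1 unfolding flat_exp_def
      by (auto intro!: derivative_eq_intros DERIV_chain2[OF poly_DERIV]
          simp: field_simps power2_eq_square)
    then show ?thesis
      by (rule has_field_derivative_transform_within_open[where S = "{0<..}"])
        (use 1 in \<open>auto simp: flat_exp_def\<close>)
  next
    case 2
    have "((\<lambda>x. 0) has_real_derivative 0) (at x)" by simp
    then have "(flat_exp p has_real_derivative 0) (at x)"
      by (rule has_field_derivative_transform_within_open[where S = "{..<0}"])
        (use 2 in \<open>auto simp: flat_exp_def\<close>)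
    then show ?thesis using 2 by (simp add: flat_exp_def)
  next
    case 3
    \<comment> \<open>With $t = 1/y$ the quotient is $t P(t) e^{-t}$.\<close>
    have "((\<lambda>y. flat_exp p y / y) \<longlongrightarrow> 0) (at_right 0)"
    proof -
      have "((\<lambda>y. poly (pCons 0 p) y * exp (- y)) \<longlongrightarrow> 0) at_top"
        by (rule poly_times_exp_tendsto_0)
      then have "((\<lambda>x. poly (pCons 0 p) (inverse x) * exp (- inverse x)) \<longlongrightarrow> 0) (at_right 0)"
        by (rule filterlim_compose[OF _ filterlim_inverse_at_top_right])
      then show ?thesis
        by (rule Lim_transform_eventually)
          (auto simp: eventually_at_filter flat_exp_def field_simps)
    qed
    moreover have "((\<lambda>y. flat_exp p y / y) \<longlongrightarrow> 0) (at_left 0)"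
      by (rule tendsto_eventually) (auto simp: eventually_at_filter flat_exp_def)
    ultimately have "((\<lambda>y. flat_exp p y / y) \<longlongrightarrow> 0) (at 0)"
      by (rule filterlim_split_at[rotated])
    then show ?thesis
      using 3 by (simp add: DERIV_def flat_exp_def)
  qed
qed

lemma flat_exp_smooth: "differentiable_times n (flat_exp p)"
  using flat_exp_has_derivative by (induction n arbitrary: p) auto

lemma flat_exp_1_pos: "x > 0 \<Longrightarrow> flat_exp 1 x > 0"
  and flat_exp_1_le_1: "flat_exp 1 x \<le> 1"
  and flat_exp_1_nonneg: "flat_exp 1 x \<ge> 0"
  and flat_exp_eq_0: "x \<le> 0 \<Longrightarrow> flat_exp p x = 0"
  by (auto simp: flat_exp_def)

lemma test_functionI:
  assumes "\<And>n. differentiable_times n \<phi>" "\<And>x. x \<notin> {a..b} \<Longrightarrow> \<phi> x = 0" "0 < a" "b < h"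
  shows "test_function h \<phi>"
proof -
  have sub: "closure {x. \<phi> x \<noteq> 0} \<subseteq> {a..b}"
    by (rule closure_minimal) (use assms(2) in blast, simp)
  then have "compact (closure {x. \<phi> x \<noteq> 0})"
    by (meson bounded_closed_interval bounded_subset closed_closure compact_eq_bounded_closed)
  then show ?thesis
    using sub assms unfolding test_function_def smooth_iff_differentiable_times by force
qed

lemma test_functionE:
  assumes "test_function h \<phi>" "h > 0"
  obtains a b where "0 < a" "a \<le> b" "b < h" "\<And>x. x \<notin> {a..b} \<Longrightarrow> \<phi> x = 0"
proof (cases "closure {x. \<phi> x \<noteq> 0} = {}")
  case True
  then have "\<phi> x = 0" for x
    using closure_subset by fastforce
  then show ?thesis using that[of "h/2" "h/2"] \<open>h > 0\<close> by auto
next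
  case False
  have c: "compact (closure {x. \<phi> x \<noteq> 0})" and s: "closure {x. \<phi> x \<noteq> 0} \<subseteq> {0<..<h}"
    using assms by (auto simp: test_function_def)
  obtain a where a: "a \<in> closure {x. \<phi> x \<noteq> 0}" "\<And>x. x \<in> closure {x. \<phi> x \<noteq> 0} \<Longrightarrow> a \<le> x"
    using compact_attains_inf[OF c False] by blast
  obtain b where b: "b \<in> closure {x. \<phi> x \<noteq> 0}" "\<And>x. x \<in> closure {x. \<phi> x \<noteq> 0} \<Longrightarrow> x \<le> b"
    using compact_attains_sup[OF c False] by blast
  have "\<phi> x = 0" if "x \<notin> {a..b}" for x
    using a(2)[of x] b(2)[of x] that closure_subset[of "{x. \<phi> x \<noteq> 0}"] by auto
  then show ?thesis
    using that[of a b] a(1) a(2)[OF b(1)] b(1) s by (meson greaterThanLessThan_iff subsetD)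
qed

lemma test_function_differentiable_times: "test_function h \<phi> \<Longrightarrow> differentiable_times n \<phi>"
  using smooth_iff_differentiable_times unfolding test_function_def by blast

lemma test_function_has_derivative:
  assumes "test_function h \<phi>"
  shows "(\<phi> has_real_derivative deriv \<phi> x) (at x)"
  using assms[unfolded test_function_def, THEN conjunct1, rule_format, of 0 x]
  by (simp add: field_differentiable_derivI)

lemma test_function_continuous:
  assumes "test_function h \<phi>"
  shows "continuous_on S \<phi>"
  using test_function_has_derivative[OF assms]
  by (intro continuous_at_imp_continuous_on ballI DERIV_isCont)

lemma test_function_deriv_continuous:
  assumes "test_function h \<phi>"
  shows "continuous_on S (deriv \<phi>)"
proof -
  have "deriv \<phi> field_differentiable (at x)" for x
    using assms[unfolded test_function_def, THEN conjunct1, rule_format, of 1 x] by simp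
  then show ?thesis
    by (intro continuous_at_imp_continuous_on ballI field_differentiable_imp_continuous_at)
qed

text \<open>
  Since $f$ vanishes to the left of $a$, the convention that the integral over the empty
  interval is $0$ is the right continuation of the primitive to the left of $a$.
\<close>

lemma has_derivative_integral_of_supported:
  fixes f :: "real \<Rightarrow> real"
  assumes "continuous_on UNIV f" "\<And>x. x < a \<Longrightarrow> f x = 0"
  shows "((\<lambda>x. integral {a..x} f) has_real_derivative f x) (at x)"
proof -
  define c where "c = min a x - 1"
  have int: "f integrable_on {u..v}" for u v
    using assms(1) by (meson continuous_on_subset integrable_continuous_real subset_UNIV)
  have fa: "f a = 0"
  proof -
    have "f \<midarrow>a\<rightarrow> f a" using assms(1) by (simp add: continuous_on_def)
    then have "(f \<longlongrightarrow> f a) (at_left a)" by (rule tendsto_mono[OF at_le, rotated]) simp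
    moreover have "(f \<longlongrightarrow> 0) (at_left a)"
      by (rule tendsto_eventually) (auto simp: eventually_at_filter assms(2))
    ultimately show ?thesis by (rule tendsto_unique[OF trivial_limit_at_left_real])
  qed
  have eq: "integral {c..y} f = integral {a..y} f" if "y > c" for y
  proof -
    have z: "integral {c..u} f = 0" if "u \<le> a" for u
    proof -
      have "integral {c..u} f = integral {c..u} (\<lambda>x. 0)"
        by (rule integral_cong) (use that assms(2) fa in \<open>force simp: le_less\<close>)
      then show ?thesis by simp
    qed
    show ?thesis
    proof (cases "y \<ge> a")
      case True
      then show ?thesis
        using Henstock_Kurzweil_Integration.integral_combine[of c a y f] int z[of a] by (auto simp: c_def)
    next
      case False
      then show ?thesis using z[of y] by simp
    qed
  qed
  have "((\<lambda>y. integral {c..y} f) has_real_derivative f x) (at x within {c..x + 1})"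
    by (rule integral_has_real_derivative)
      (use assms(1) in \<open>auto simp: c_def intro: continuous_on_subset\<close>)
  then have "((\<lambda>y. integral {c..y} f) has_real_derivative f x) (at x)"
    by (subst (asm) at_within_Icc_at) (auto simp: c_def)
  then show ?thesis
    by (rule has_field_derivative_transform_within_open[where S = "{c<..}"])
      (use eq in \<open>auto simp: c_def\<close>)
qed

text \<open>
  The vanishing mean is what makes the primitive vanish again to the right of the support.
\<close>

lemma test_function_primitive:
  assumes "test_function h \<psi>" "h > 0" "integral {0..h} \<psi> = 0"
  obtains \<phi> where "test_function h \<phi>" "deriv \<phi> = \<psi>"
proof -
  obtain a b where ab: "0 < a" "a \<le> b" "b < h" "\<And>x. x \<notin> {a..b} \<Longrightarrow> \<psi> x = 0"
    using test_functionE[OF assms(1,2)] by blast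
  define \<phi> where "\<phi> x = integral {a..x} \<psi>" for x
  note cont = test_function_continuous[OF assms(1), of UNIV]
  have int: "\<psi> integrable_on {u..v}" for u v
    using cont by (meson continuous_on_subset integrable_continuous_real subset_UNIV)
  have der: "(\<phi> has_real_derivative \<psi> x) (at x)" for x
    unfolding \<phi>_def by (rule has_derivative_integral_of_supported[OF cont]) (use ab(4) in auto)
  have "differentiable_times n \<phi>" for n
    using der test_function_differentiable_times[OF assms(1)] by (cases n) auto
  moreover have "\<phi> x = 0" if "x \<notin> {a..b}" for x
  proof (cases "x < a")
    case False
    then have "x > b" using that by auto
    have 1: "integral {a..v} \<psi> = integral {a..b} \<psi>" if "b \<le> v" for v
      by (rule integral_spike_set; rule negligible_subset[OF negligible_empty]) (use ab that in auto)
    have 2: "integral {0..h} \<psi> = integral {a..b} \<psi>"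
      by (rule integral_spike_set; rule negligible_subset[OF negligible_empty]) (use ab in auto)
    show ?thesis using 1[of x] 2 assms(3) \<open>x > b\<close> by (simp add: \<phi>_def)
  qed (simp add: \<phi>_def)
  ultimately have "test_function h \<phi>"
    using ab by (intro test_functionI[of \<phi> a b h]) auto
  moreover have "deriv \<phi> = \<psi>" using der by (auto intro: DERIV_imp_deriv)
  ultimately show ?thesis by (rule that)
qed

text \<open>
  The parameter $c$ is a steepness: as $c$ grows, the bump on $[a,b]$ increases to the indicator of
  $(a,b)$ while it stays below $1$.
\<close>

definition bump :: "real \<Rightarrow> real \<Rightarrow> real \<Rightarrow> real \<Rightarrow> real" where
  "bump c a b x = flat_exp 1 (c * (x - a)) * flat_exp 1 (c * (b - x))"

lemma test_function_bump:
  assumes "c > 0" "0 < a" "b < h"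
  shows "test_function h (bump c a b)"
proof (rule test_functionI)
  have "bump c a b = (\<lambda>x. flat_exp 1 (c * x + (- c * a)) * flat_exp 1 ((- c) * x + c * b))"
    by (auto simp: bump_def algebra_simps)
  then show "differentiable_times n (bump c a b)" for n
    by (simp only:) (intro differentiable_times_mult differentiable_times_affine flat_exp_smooth)
  show "bump c a b x = 0" if "x \<notin> {a..b}" for x
    using that assms(1) unfolding bump_def
    by (auto simp: not_le mult_le_0_iff intro!: flat_exp_eq_0)
qed (use assms in auto)

lemma bump_nonneg: "bump c a b x \<ge> 0" and bump_le_1: "bump c a b x \<le> 1"
  by (simp_all add: bump_def flat_exp_1_nonneg flat_exp_1_le_1 mult_le_one)

lemma bump_tendsto_indicator: "(\<lambda>n. bump (real (Suc n)) a b x) \<longlonglongrightarrow> indicator {a<..<b} x"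
proof (cases "x \<in> {a<..<b}")
  case True
  have lim: "(\<lambda>n. flat_exp 1 (real (Suc n) * t)) \<longlonglongrightarrow> 1" if "t > 0" for t
  proof -
    have "(\<lambda>n. exp (- (1 / t) * inverse (real (Suc n)))) \<longlonglongrightarrow> exp (- (1 / t) * 0)"
      by (intro tendsto_intros LIMSEQ_inverse_real_of_nat)
    moreover have "exp (- (1 / t) * inverse (real (Suc n))) = flat_exp 1 (real (Suc n) * t)" for n
      using that mult_pos_pos[of "real (Suc n)" t] by (simp add: flat_exp_def inverse_eq_divide)
    ultimately show ?thesis by simp
  qed
  have "(\<lambda>n. bump (real (Suc n)) a b x) \<longlonglongrightarrow> 1 * 1"
    unfolding bump_def by (intro tendsto_mult lim) (use True in auto)
  then show ?thesis using True by simp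
next
  case False
  then have "bump (real (Suc n)) a b x = 0" for n
    by (auto simp: bump_def not_less mult_le_0_iff intro!: flat_exp_eq_0)
  then show ?thesis using False by simp
qed

lemma test_function_unit_integral:
  assumes "h > 0"
  obtains \<rho> where "test_function h \<rho>" "integral {0..h} \<rho> = 1"
proof -
  define \<beta> where "\<beta> = bump 1 (h/3) (2*h/3)"
  have \<beta>: "test_function h \<beta>"
    unfolding \<beta>_def by (rule test_function_bump) (use assms in auto)
  note cont = test_function_continuous[OF \<beta>]
  have int: "\<beta> integrable_on {0..h}"
    using cont by (rule integrable_continuous_real)
  have "integral {0..h} \<beta> \<noteq> 0"
  proof
    assume "integral {0..h} \<beta> = 0"
    then have "\<beta> (h/2) = 0"
      using integral_eq_0_iff[of 0 h \<beta>] assms cont by (auto simp: \<beta>_def bump_nonneg)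
    moreover have "\<beta> (h/2) > 0"
      unfolding \<beta>_def bump_def using assms by (intro mult_pos_pos flat_exp_1_pos) auto
    ultimately show False by simp
  qed
  then have "integral {0..h} (\<lambda>x. inverse (integral {0..h} \<beta>) * \<beta> x) = 1"
    by simp
  moreover have "test_function h (\<lambda>x. inverse (integral {0..h} \<beta>) * \<beta> x)"
  proof -
    obtain a b where ab: "0 < a" "a \<le> b" "b < h" "\<And>x. x \<notin> {a..b} \<Longrightarrow> \<beta> x = 0"
      using test_functionE[OF \<beta> assms] by blast
    then show ?thesis
      by (intro test_functionI[where a = a and b = b] differentiable_times_mult differentiable_times_const
          test_function_differentiable_times[OF \<beta>]) auto
  qed
  ultimately show ?thesis by (rule that[rotated])
qed

section \<open>Square-integrable functions on an interval\<close>

lemma integrable_lebesgue_on_Ioo_iff: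
  fixes f :: "real \<Rightarrow> 'a::euclidean_space"
  shows "integrable (lebesgue_on {a<..<b}) f \<longleftrightarrow> f absolutely_integrable_on {a..b}"
proof -
  have "integrable (lebesgue_on {a<..<b}) f \<longleftrightarrow> f absolutely_integrable_on {a<..<b}"
    unfolding set_integrable_def by (rule integrable_restrict_space) simp
  then show ?thesis using absolutely_integrable_on_open_interval[where f = f and a = a and b = b] by simp
qed

lemma integral_lebesgue_on_Ioo:
  fixes f :: "real \<Rightarrow> 'a::euclidean_space"
  assumes "f absolutely_integrable_on {a..b}"
  shows "(LINT x|lebesgue_on {a<..<b}. f x) = integral {a..b} f"
  using lebesgue_integral_eq_integral[of "{a<..<b}" f] assms
  by (simp add: integrable_lebesgue_on_Ioo_iff integral_open_interval_real)

lemma finite_measure_Ioo: "finite_measure (lebesgue_on {a<..<b::real})"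
  by (rule finite_measure_lebesgue_on) (metis box_real(1) lmeasurable_box)

lemma integrable_const_Ioo: "integrable (lebesgue_on {a<..<b::real}) (\<lambda>x. c :: 'a::euclidean_space)"
  by (rule finite_measure.integrable_const[OF finite_measure_Ioo])

lemma continuous_measurable_Ioo:
  fixes g :: "real \<Rightarrow> 'a::euclidean_space"
  assumes "continuous_on {a..b} g"
  shows "g \<in> borel_measurable (lebesgue_on {a<..<b})"
  by (rule continuous_imp_measurable_on_sets_lebesgue)
    (auto intro: continuous_on_subset[OF assms])

lemma AE_Ioo_I: "(\<And>x. a < x \<Longrightarrow> x < b \<Longrightarrow> P x) \<Longrightarrow> AE x in lebesgue_on {a<..<b::real}. P x"
  by (rule AE_I2) auto

lemma L2_measurable: "f \<in> L2 h \<Longrightarrow> f \<in> borel_measurable (lebesgue_on {0<..<h})"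
  by (simp add: L2_def)

lemma L2_square_integrable: "f \<in> L2 h \<Longrightarrow> integrable (lebesgue_on {0<..<h}) (\<lambda>x. (cmod (f x))\<^sup>2)"
  by (simp add: L2_def)

lemma L2_I_dominated:
  assumes "f \<in> borel_measurable (lebesgue_on {0<..<h})"
    "integrable (lebesgue_on {0<..<h}) w"
    "AE x in lebesgue_on {0<..<h}. (cmod (f x))\<^sup>2 \<le> w x"
  shows "f \<in> L2 h"
  unfolding L2_def
proof (intro CollectI conjI assms(1))
  show "integrable (lebesgue_on {0<..<h}) (\<lambda>x. (cmod (f x))\<^sup>2)"
    by (rule Bochner_Integration.integrable_bound[OF assms(2)]) (use assms(1,3) in \<open>auto elim!: eventually_mono\<close>)
qed

lemma L2_imp_integrable:
  assumes "f \<in> L2 h"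
  shows "integrable (lebesgue_on {0<..<h}) f"
proof (rule Bochner_Integration.integrable_bound)
  show "integrable (lebesgue_on {0<..<h}) (\<lambda>x. 1 + (cmod (f x))\<^sup>2)"
    using assms by (intro Bochner_Integration.integrable_add integrable_const_Ioo L2_square_integrable)
  \<comment> \<open>This is $(t-1)^2 + t^2 \ge 0$ with $t$ the modulus.\<close>
  have "cmod (f x) \<le> 1 + (cmod (f x))\<^sup>2" for x
    using sum_power2_ge_zero[of "cmod (f x) - 1" "cmod (f x)"] norm_ge_zero[of "f x"]
    by (simp add: power2_eq_square algebra_simps)
  then show "AE x in lebesgue_on {0<..<h}. norm (f x) \<le> norm (1 + (cmod (f x))\<^sup>2)"
    by (intro AE_I2) (simp add: add_nonneg_nonneg)
qed (rule L2_measurable[OF assms])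

lemma L2_imp_absolutely_integrable: "f \<in> L2 h \<Longrightarrow> f absolutely_integrable_on {0..h}"
  using L2_imp_integrable integrable_lebesgue_on_Ioo_iff by blast

lemma cmod_lincomb_square_le: "(cmod (a * u + b * v))\<^sup>2 \<le> 2 * (cmod a)\<^sup>2 * (cmod u)\<^sup>2 + 2 * (cmod b)\<^sup>2 * (cmod v)\<^sup>2"
proof -
  have "(cmod (a * u + b * v))\<^sup>2 \<le> (cmod (a * u) + cmod (b * v))\<^sup>2"
    by (intro power_mono norm_triangle_ineq) auto
  also have "\<dots> \<le> 2 * (cmod (a * u))\<^sup>2 + 2 * (cmod (b * v))\<^sup>2"
    using zero_le_power2[of "cmod (a * u) - cmod (b * v)"] by (simp add: power2_eq_square algebra_simps)
  finally show ?thesis by (simp add: norm_mult power_mult_distrib)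
qed

lemma L2_lincomb:
  assumes "f \<in> L2 h" "g \<in> L2 h"
  shows "(\<lambda>x. a * f x + b * g x) \<in> L2 h"
proof (rule L2_I_dominated)
  show "(\<lambda>x. a * f x + b * g x) \<in> borel_measurable (lebesgue_on {0<..<h})"
    by (intro borel_measurable_add borel_measurable_times borel_measurable_const L2_measurable assms)
  show "integrable (lebesgue_on {0<..<h})
      (\<lambda>x. 2 * (cmod a)\<^sup>2 * (cmod (f x))\<^sup>2 + 2 * (cmod b)\<^sup>2 * (cmod (g x))\<^sup>2)"
    using assms by (intro Bochner_Integration.integrable_add integrable_mult_right L2_square_integrable)
  show "AE x in lebesgue_on {0<..<h}. (cmod (a * f x + b * g x))\<^sup>2
      \<le> 2 * (cmod a)\<^sup>2 * (cmod (f x))\<^sup>2 + 2 * (cmod b)\<^sup>2 * (cmod (g x))\<^sup>2"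
    by (intro AE_I2 cmod_lincomb_square_le)
qed

lemma continuous_on_Icc_bounded:
  fixes g :: "real \<Rightarrow> 'a::real_normed_vector"
  assumes "continuous_on {a..b} g"
  obtains K where "K > 0" "\<And>x. x \<in> {a..b} \<Longrightarrow> norm (g x) \<le> K"
proof -
  have "bounded (g ` {a..b})"
    using assms by (intro compact_imp_bounded compact_continuous_image) auto
  then show ?thesis using that by (auto simp: bounded_pos)
qed

lemma L2_bounded:
  assumes "f \<in> borel_measurable (lebesgue_on {0<..<h})"
    "AE x in lebesgue_on {0<..<h}. cmod (f x) \<le> K"
  shows "f \<in> L2 h"
  by (rule L2_I_dominated[where w = "\<lambda>x. K\<^sup>2"])
    (use assms in \<open>auto intro!: integrable_const_Ioo power_mono elim!: eventually_mono\<close>)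

lemma continuous_imp_L2:
  assumes "continuous_on {0..h} f"
  shows "f \<in> L2 h"
proof -
  obtain K where "\<And>x. x \<in> {0..h} \<Longrightarrow> norm (f x) \<le> K"
    using continuous_on_Icc_bounded[OF assms] by blast
  then show ?thesis
    by (intro L2_bounded[where K = K] continuous_measurable_Ioo assms AE_Ioo_I) auto
qed

lemma L2_mult_bounded:
  assumes "f \<in> L2 h" "g \<in> borel_measurable (lebesgue_on {0<..<h})"
    "AE x in lebesgue_on {0<..<h}. cmod (g x) \<le> K"
  shows "(\<lambda>x. f x * g x) \<in> L2 h"
proof (rule L2_I_dominated)
  show "(\<lambda>x. f x * g x) \<in> borel_measurable (lebesgue_on {0<..<h})"
    by (intro borel_measurable_times L2_measurable assms)
  show "integrable (lebesgue_on {0<..<h}) (\<lambda>x. K\<^sup>2 * (cmod (f x))\<^sup>2)"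
    using assms by (intro integrable_mult_right L2_square_integrable)
  show "AE x in lebesgue_on {0<..<h}. (cmod (f x * g x))\<^sup>2 \<le> K\<^sup>2 * (cmod (f x))\<^sup>2"
    using assms(3)
    by eventually_elim (simp add: norm_mult power_mult_distrib mult.commute[of "(cmod (f _))\<^sup>2"] mult_right_mono power_mono)
qed

lemma L2_mult_continuous:
  assumes "f \<in> L2 h" "continuous_on {0..h} g"
  shows "(\<lambda>x. f x * g x) \<in> L2 h"
proof -
  obtain K where "\<And>x. x \<in> {0..h} \<Longrightarrow> norm (g x) \<le> K"
    using continuous_on_Icc_bounded[OF assms(2)] by blast
  then show ?thesis
    by (intro L2_mult_bounded[where K = K] continuous_measurable_Ioo assms AE_Ioo_I) auto
qed

lemma absolutely_integrable_mult_continuous: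
  fixes f g :: "real \<Rightarrow> complex"
  assumes "f absolutely_integrable_on {a..b}" "continuous_on {a..b} g"
  shows "(\<lambda>x. f x * g x) absolutely_integrable_on {a..b}"
proof -
  obtain K where K: "K > 0" "\<And>x. x \<in> {a..b} \<Longrightarrow> norm (g x) \<le> K"
    using continuous_on_Icc_bounded[OF assms(2)] by blast
  have f: "integrable (lebesgue_on {a<..<b}) f"
    using assms integrable_lebesgue_on_Ioo_iff by blast
  have "integrable (lebesgue_on {a<..<b}) (\<lambda>x. f x * g x)"
  proof (rule Bochner_Integration.integrable_bound)
    show "integrable (lebesgue_on {a<..<b}) (\<lambda>x. of_real K * f x)"
      using f by simp
    show "(\<lambda>x. f x * g x) \<in> borel_measurable (lebesgue_on {a<..<b})"
      using f continuous_measurable_Ioo[OF assms(2)] by auto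
    show "AE x in lebesgue_on {a<..<b}. norm (f x * g x) \<le> norm (of_real K * f x)"
      using K by (intro AE_Ioo_I) (simp add: norm_mult mult.commute[of "cmod (f _)"] mult_right_mono)
  qed
  then show ?thesis using integrable_lebesgue_on_Ioo_iff by blast
qed

lemma norm_L2_nonneg: "norm_L2 h f \<ge> 0"
  by (simp add: norm_L2_def)

lemma norm_L2_square: "(norm_L2 h f)\<^sup>2 = (LINT x|lebesgue_on {0<..<h}. (cmod (f x))\<^sup>2)"
  by (simp add: norm_L2_def)

lemma norm_L2_cong:
  assumes "f \<in> borel_measurable (lebesgue_on {0<..<h})" "g \<in> borel_measurable (lebesgue_on {0<..<h})"
    "eq_L2 h f g"
  shows "norm_L2 h f = norm_L2 h g"
  unfolding norm_L2_def
  using assms by (auto simp: eq_L2_def intro!: integral_cong_AE elim!: eventually_mono)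

lemma norm_L2_dominated:
  assumes "f \<in> borel_measurable (lebesgue_on {0<..<h})" "integrable (lebesgue_on {0<..<h}) w"
    "AE x in lebesgue_on {0<..<h}. (cmod (f x))\<^sup>2 \<le> w x"
  shows "(norm_L2 h f)\<^sup>2 \<le> (LINT x|lebesgue_on {0<..<h}. w x)"
  unfolding norm_L2_square
  by (rule integral_mono_AE) (use L2_square_integrable[OF L2_I_dominated[OF assms]] assms in auto)

lemma measure_Ioo: "h > 0 \<Longrightarrow> measure (lebesgue_on {0<..<h}) (space (lebesgue_on {0<..<h})) = h"
  by (simp add: measure_restrict_space)

lemma norm_L2_le_sup:
  assumes "h > 0" "f \<in> borel_measurable (lebesgue_on {0<..<h})" "K \<ge> 0"
    "AE x in lebesgue_on {0<..<h}. cmod (f x) \<le> K"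
  shows "norm_L2 h f \<le> sqrt h * K"
proof -
  have "(norm_L2 h f)\<^sup>2 \<le> (LINT x|lebesgue_on {0<..<h}. K\<^sup>2)"
    by (rule norm_L2_dominated) (use assms in \<open>auto intro!: integrable_const_Ioo power_mono elim!: eventually_mono\<close>)
  also have "\<dots> = (sqrt h * K)\<^sup>2"
    using assms measure_Ioo[of h] by (simp add: power_mult_distrib)
  finally show ?thesis using assms by (simp add: power2_le_iff_abs_le)
qed

text \<open>
  The Cauchy-Schwarz inequality against the constant $1$, obtained from the fact that the variance of
  $|f|$ is not negative.
\<close>

lemma L1_le_norm_L2:
  assumes "h > 0" "f \<in> L2 h"
  shows "integral {0..h} (\<lambda>x. cmod (f x)) \<le> sqrt h * norm_L2 h f"
proof -
  let ?M = "lebesgue_on {0<..<h}"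
  have int: "integrable ?M (\<lambda>x. cmod (f x))"
    using L2_imp_integrable[OF assms(2)] by simp
  define s where "s = (LINT x|?M. cmod (f x))"
  have eq: "s = integral {0..h} (\<lambda>x. cmod (f x))"
    unfolding s_def using int by (intro integral_lebesgue_on_Ioo) (simp add: integrable_lebesgue_on_Ioo_iff)
  have "0 \<le> (LINT x|?M. (cmod (f x) - s / h)\<^sup>2)"
    by simp
  also have "(\<lambda>x. (cmod (f x) - s / h)\<^sup>2) = (\<lambda>x. (cmod (f x))\<^sup>2 - 2 * s / h * cmod (f x) + (s / h)\<^sup>2)"
    by (auto simp: power2_eq_square algebra_simps)
  also have "(LINT x|?M. (cmod (f x))\<^sup>2 - 2 * s / h * cmod (f x) + (s / h)\<^sup>2)
      = (norm_L2 h f)\<^sup>2 - 2 * s / h * s + h * (s / h)\<^sup>2"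
    using L2_square_integrable[OF assms(2)] int measure_Ioo[OF assms(1)] integrable_const_Ioo[of 0 h "(s/h)\<^sup>2"]
    by (simp add: norm_L2_square s_def)
  also have "\<dots> = (norm_L2 h f)\<^sup>2 - s\<^sup>2 / h"
    using assms(1) by (simp add: power2_eq_square)
  finally have "s\<^sup>2 \<le> (sqrt h * norm_L2 h f)\<^sup>2"
    using assms(1) by (simp add: power_mult_distrib field_simps)
  then show ?thesis
    using eq norm_L2_nonneg[of h f] assms(1) by (simp add: power2_le_iff_abs_le)
qed

lemma norm_L2_lincomb_le:
  assumes "f \<in> L2 h" "g \<in> L2 h"
  shows "(norm_L2 h (\<lambda>x. a * f x + b * g x))\<^sup>2 \<le> 2 * (cmod a)\<^sup>2 * (norm_L2 h f)\<^sup>2 + 2 * (cmod b)\<^sup>2 * (norm_L2 h g)\<^sup>2"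
proof -
  have "(norm_L2 h (\<lambda>x. a * f x + b * g x))\<^sup>2 \<le> (LINT x|lebesgue_on {0<..<h}.
      2 * (cmod a)\<^sup>2 * (cmod (f x))\<^sup>2 + 2 * (cmod b)\<^sup>2 * (cmod (g x))\<^sup>2)"
    using assms L2_lincomb[OF assms]
    by (intro norm_L2_dominated AE_I2 cmod_lincomb_square_le L2_measurable
        Bochner_Integration.integrable_add integrable_mult_right L2_square_integrable)
  also have "\<dots> = 2 * (cmod a)\<^sup>2 * (norm_L2 h f)\<^sup>2 + 2 * (cmod b)\<^sup>2 * (norm_L2 h g)\<^sup>2"
    using assms by (simp add: L2_square_integrable norm_L2_square)
  finally show ?thesis .
qed

lemma norm_L2_mult_bounded:
  assumes "f \<in> L2 h" "g \<in> borel_measurable (lebesgue_on {0<..<h})" "K \<ge> 0"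
    "AE x in lebesgue_on {0<..<h}. cmod (g x) \<le> K"
  shows "norm_L2 h (\<lambda>x. f x * g x) \<le> K * norm_L2 h f"
proof -
  have "(norm_L2 h (\<lambda>x. f x * g x))\<^sup>2 \<le> (LINT x|lebesgue_on {0<..<h}. K\<^sup>2 * (cmod (f x))\<^sup>2)"
  proof (rule norm_L2_dominated)
    show "AE x in lebesgue_on {0<..<h}. (cmod (f x * g x))\<^sup>2 \<le> K\<^sup>2 * (cmod (f x))\<^sup>2"
      using assms(4)
      by eventually_elim (simp add: norm_mult power_mult_distrib mult.commute[of "(cmod (f _))\<^sup>2"] mult_right_mono power_mono)
  qed (use assms in \<open>auto dest: L2_measurable L2_square_integrable\<close>)
  also have "\<dots> = (K * norm_L2 h f)\<^sup>2"
    by (simp add: norm_L2_square power_mult_distrib)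
  finally show ?thesis using assms norm_L2_nonneg[of h f] by (simp add: power2_le_iff_abs_le)
qed

lemma eq_L2_refl: "eq_L2 h f f" by (simp add: eq_L2_def)

lemma eq_L2_sym: "eq_L2 h f g \<Longrightarrow> eq_L2 h g f"
  by (auto simp: eq_L2_def elim!: eventually_mono)

lemma eq_L2_trans: "eq_L2 h f g \<Longrightarrow> eq_L2 h g k \<Longrightarrow> eq_L2 h f k"
  unfolding eq_L2_def by (auto elim: eventually_elim2)

lemma eq_L2_I: "(\<And>x. 0 < x \<Longrightarrow> x < h \<Longrightarrow> f x = g x) \<Longrightarrow> eq_L2 h f g"
  unfolding eq_L2_def by (rule AE_Ioo_I)

lemma eq_L2_negligibleE:
  assumes "eq_L2 h f g"
  obtains N where "negligible N" "\<And>x. x \<in> {0<..<h} - N \<Longrightarrow> f x = g x"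
proof -
  have "AE x in lebesgue. x \<in> {0<..<h} \<longrightarrow> f x = g x"
    using assms unfolding eq_L2_def by (subst (asm) AE_restrict_space_iff) auto
  then show ?thesis
    using that unfolding eventually_ae_filter_negligible by fastforce
qed

lemma eq_L2_integral:
  assumes "eq_L2 h f g" "x \<le> h"
  shows "integral {0..x} f = integral {0..x} g"
proof -
  obtain N where N: "negligible N" "\<And>x. x \<in> {0<..<h} - N \<Longrightarrow> f x = g x"
    using eq_L2_negligibleE[OF assms(1)] by blast
  show ?thesis
  proof (rule integral_spike)
    show "negligible (insert 0 (insert h N))" using N(1) by (simp add: negligible_insert)
    show "g y = f y" if "y \<in> {0..x} - insert 0 (insert h N)" for y
      using N(2)[of y] that assms(2) by auto
  qed
qed

text \<open>
  This makes the boundary values independent of the continuous representative.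
\<close>

lemma eq_L2_continuous_unique:
  assumes "h > 0" "continuous_on {0..h} f" "continuous_on {0..h} g" "eq_L2 h f g" "x \<in> {0..h}"
  shows "f x = g x"
proof -
  have cl: "closed {x \<in> {0..h}. f x - g x = 0}"
    using assms(2,3) by (intro continuous_closed_preimage_constant continuous_intros) auto
  have ae: "AE x\<in>{0<..<h} in lebesgue. x \<in> {x \<in> {0..h}. f x - g x = 0}"
    using assms(4) unfolding eq_L2_def by (subst (asm) AE_restrict_space_iff) (auto elim!: eventually_mono)
  have "{0<..<h} \<subseteq> {x \<in> {0..h}. f x - g x = 0}"
    using mem_closed_if_AE_lebesgue_open[OF open_greaterThanLessThan cl ae] by blast
  then have "closure {0<..<h} \<subseteq> {x \<in> {0..h}. f x - g x = 0}"
    by (rule closure_minimal[OF _ cl])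
  then show ?thesis using assms(1,5) by (auto simp: closure_greaterThanLessThan)
qed

section \<open>Absolutely continuous functions\<close>

text \<open>
  On $[0,h]$ the function $f$ is absolutely continuous with almost everywhere derivative $g$. The
  integral form avoids pointwise derivatives, and it is invariant under changes of $g$ on null sets.
\<close>

definition has_ac_deriv :: "real \<Rightarrow> (real \<Rightarrow> complex) \<Rightarrow> (real \<Rightarrow> complex) \<Rightarrow> bool" where
  "has_ac_deriv h f g \<longleftrightarrow>
     g absolutely_integrable_on {0..h} \<and> (\<forall>x\<in>{0..h}. f x = f 0 + integral {0..x} g)"

lemma has_ac_deriv_eq:
  "has_ac_deriv h f g \<Longrightarrow> 0 \<le> x \<Longrightarrow> x \<le> h \<Longrightarrow> f x = f 0 + integral {0..x} g"
  unfolding has_ac_deriv_def by (metis atLeastAtMost_iff)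

lemma has_ac_deriv_absint: "has_ac_deriv h f g \<Longrightarrow> g absolutely_integrable_on {0..h}"
  by (simp only: has_ac_deriv_def)

lemma has_ac_deriv_integrable:
  assumes "has_ac_deriv h f g" "0 \<le> x" "x \<le> y" "y \<le> h"
  shows "g absolutely_integrable_on {x..y}" "g integrable_on {x..y}" "(\<lambda>t. norm (g t)) integrable_on {x..y}"
proof -
  show "g absolutely_integrable_on {x..y}"
    using assms absolutely_integrable_on_subinterval[where f = g and S = "{0..h}" and a = x and b = y] has_ac_deriv_absint by fastforce
  then show "g integrable_on {x..y}" "(\<lambda>t. norm (g t)) integrable_on {x..y}"
    by (simp_all add: absolutely_integrable_on_def)
qed

lemma has_ac_deriv_continuous:
  assumes "has_ac_deriv h f g"
  shows "continuous_on {0..h} f"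
proof -
  have "g integrable_on {0..h}"
    using assms has_ac_deriv_absint by (simp add: absolutely_integrable_on_def)
  then have "continuous_on {0..h} (\<lambda>x. f 0 + integral {0..x} g)"
    by (intro continuous_intros indefinite_integral_continuous_1)
  then show ?thesis
    by (rule continuous_on_eq) (metis assms atLeastAtMost_iff has_ac_deriv_eq)
qed

lemma has_ac_deriv_diff:
  assumes "has_ac_deriv h f g" "0 \<le> x" "x \<le> y" "y \<le> h"
  shows "f y - f x = integral {x..y} g"
proof -
  have "integral {0..x} g + integral {x..y} g = integral {0..y} g"
    using has_ac_deriv_integrable(2)[OF assms(1), of 0 y] assms
    by (intro Henstock_Kurzweil_Integration.integral_combine) auto
  moreover have "f x - f 0 = integral {0..x} g" "f y - f 0 = integral {0..y} g"
    using assms has_ac_deriv_eq[OF assms(1), of x] has_ac_deriv_eq[OF assms(1), of y] by (metis add_diff_cancel_left' order_trans)+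
  ultimately show ?thesis by (simp add: algebra_simps)
qed

lemma has_ac_deriv_lincomb:
  assumes "has_ac_deriv h f f'" "has_ac_deriv h g g'"
  shows "has_ac_deriv h (\<lambda>x. a * f x + b * g x) (\<lambda>x. a * f' x + b * g' x)"
  unfolding has_ac_deriv_def
proof (intro conjI ballI)
  show "(\<lambda>x. a * f' x + b * g' x) absolutely_integrable_on {0..h}"
    using assms[unfolded has_ac_deriv_def, THEN conjunct1]
    by (intro set_integral_add set_integrable_mult_right)
  fix x assume x: "x \<in> {0..h}"
  have "integral {0..x} (\<lambda>x. a * f' x + b * g' x) = a * integral {0..x} f' + b * integral {0..x} g'"
    using x has_ac_deriv_integrable(2)[OF assms(1), of 0 x] has_ac_deriv_integrable(2)[OF assms(2), of 0 x]
    by (simp add: Henstock_Kurzweil_Integration.integral_add integrable_on_mult_right)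
  moreover have "integral {0..x} f' = f x - f 0" "integral {0..x} g' = g x - g 0"
    using x has_ac_deriv_diff[OF assms(1), of 0 x] has_ac_deriv_diff[OF assms(2), of 0 x] by auto
  ultimately show "a * f x + b * g x = a * f 0 + b * g 0 + integral {0..x} (\<lambda>x. a * f' x + b * g' x)"
    by (simp add: algebra_simps)
qed

lemma has_ac_deriv_minus:
  assumes "has_ac_deriv h f f'" "has_ac_deriv h g g'"
  shows "has_ac_deriv h (\<lambda>x. f x - g x) (\<lambda>x. f' x - g' x)"
  using has_ac_deriv_lincomb[OF assms, of 1 "-1"] by simp

lemma has_ac_deriv_integral:
  assumes "g absolutely_integrable_on {0..h}"
  shows "has_ac_deriv h (\<lambda>x. c + integral {0..x} g) g"
  using assms by (simp add: has_ac_deriv_def)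

lemma has_ac_deriv_eq_L2:
  assumes "has_ac_deriv h f g" "eq_L2 h g g'" "g' absolutely_integrable_on {0..h}"
  shows "has_ac_deriv h f g'"
  using assms eq_L2_integral[OF assms(2)] unfolding has_ac_deriv_def by (metis atLeastAtMost_iff)

lemma has_ac_deriv_C1:
  assumes "\<And>x. x \<in> {0..h} \<Longrightarrow> (g has_vector_derivative g' x) (at x within {0..h})"
    "continuous_on {0..h} g'"
  shows "has_ac_deriv h g g'"
  unfolding has_ac_deriv_def
proof (intro conjI ballI)
  show "g' absolutely_integrable_on {0..h}"
    using assms(2) by (rule absolutely_integrable_continuous_real)
  fix x assume x: "x \<in> {0..h}"
  have "(g' has_integral g x - g 0) {0..x}"
    using x by (intro fundamental_theorem_of_calculus)
      (auto intro: has_vector_derivative_within_subset[OF assms(1)])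
  then show "g x = g 0 + integral {0..x} g'"
    by (simp add: integral_unique)
qed

text \<open>
  The product rule. Let \<open>\<Phi>\<close> be the difference of the two sides and let \<open>V x\<close> be the integral of
  the modulus of \<open>f'\<close> over \<open>{0..x}\<close>. On a subinterval $[x,y]$ one has
  \[ \Phi(y) - \Phi(x) = \int_x^y f'(t) (g(y) - g(t))\,dt + \int_x^y (f(x) - f(t)) g'(t)\,dt . \]
  Both integrals are at most $K (y-x) (V(y) - V(x))$ if $K$ bounds $g'$. As $V$ is continuous,
  the derivative of \<open>\<Phi>\<close> is $0$ everywhere, so that \<open>\<Phi>\<close> is constant.
\<close>

lemma has_ac_deriv_mult_C1:
  assumes f: "has_ac_deriv h f f'"
    and g: "\<And>x. x \<in> {0..h} \<Longrightarrow> (g has_vector_derivative g' x) (at x within {0..h})"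
    and g': "continuous_on {0..h} g'"
  shows "has_ac_deriv h (\<lambda>x. f x * g x) (\<lambda>x. f' x * g x + f x * g' x)"
proof -
  obtain K where K: "K > 0" "\<And>x. x \<in> {0..h} \<Longrightarrow> norm (g' x) \<le> K"
    using continuous_on_Icc_bounded[OF g'] by blast
  have acg: "has_ac_deriv h g g'" by (rule has_ac_deriv_C1[OF g g'])
  note cf = has_ac_deriv_continuous[OF f] and cg = has_ac_deriv_continuous[OF acg]
  let ?d = "\<lambda>x. f' x * g x + f x * g' x"
  have d: "?d absolutely_integrable_on {0..h}"
    by (intro set_integral_add absolutely_integrable_mult_continuous cg
        absolutely_integrable_continuous_real continuous_intros cf g' has_ac_deriv_absint[OF f])
  define \<Phi> where "\<Phi> x = f x * g x - integral {0..x} ?d" for x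
  define V where "V x = integral {0..x} (\<lambda>t. norm (f' t))" for x
  have V_diff: "V y - V x = integral {x..y} (\<lambda>t. norm (f' t))" if "0 \<le> x" "x \<le> y" "y \<le> h" for x y
    unfolding V_def
    using Henstock_Kurzweil_Integration.integral_combine[of 0 x y "\<lambda>t. norm (f' t)"]
      has_ac_deriv_integrable(3)[OF f, of 0 y] that by (simp add: algebra_simps)
  have V_cont: "continuous_on {0..h} V"
    unfolding V_def using f
    by (intro indefinite_integral_continuous_1) (use has_ac_deriv_absint in \<open>simp add: absolutely_integrable_on_def\<close>)
  have lipschitz: "norm (g y - g t) \<le> K * (y - x)" if "0 \<le> x" "x \<le> t" "t \<le> y" "y \<le> h" for x t y
  proof -
    have "g y - g t = integral {t..y} g'"
      using has_ac_deriv_diff[OF acg, of t y] that by auto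
    also have "norm \<dots> \<le> K * (y - t)"
      using that K by (intro integral_bound continuous_on_subset[OF g']) auto
    also have "\<dots> \<le> K * (y - x)" using that K by (intro mult_left_mono) auto
    finally show ?thesis .
  qed
  have f_diff: "norm (f x - f t) \<le> V y - V x" if "0 \<le> x" "x \<le> t" "t \<le> y" "y \<le> h" for x t y
  proof -
    have "norm (f x - f t) = norm (integral {x..t} f')"
      using has_ac_deriv_diff[OF f, of x t] that by (simp add: norm_minus_commute)
    also have "\<dots> \<le> integral {x..t} (\<lambda>t. norm (f' t))"
      using that by (intro integral_norm_bound_integral has_ac_deriv_integrable[OF f]) auto
    also have "\<dots> \<le> integral {x..y} (\<lambda>t. norm (f' t))"
      using that by (intro integral_subset_le has_ac_deriv_integrable[OF f]) auto
    finally show ?thesis using V_diff[of x y] that by simp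
  qed
  have estimate: "norm (\<Phi> y - \<Phi> x) \<le> 2 * K * (y - x) * (V y - V x)"
    if xy: "0 \<le> x" "x \<le> y" "y \<le> h" for x y
  proof -
    have sub: "{x..y} \<subseteq> {0..h}" using xy by auto
    have i1: "(\<lambda>t. f' t * (g y - g t)) integrable_on {x..y}"
      using absolutely_integrable_mult_continuous[where f = f' and a = x and b = y and g = "\<lambda>t. g y - g t",
          OF has_ac_deriv_integrable(1)[OF f xy]
            continuous_on_diff[OF continuous_on_const continuous_on_subset[OF cg sub]]]
      by (simp add: absolutely_integrable_on_def)
    have i2: "(\<lambda>t. (f x - f t) * g' t) integrable_on {x..y}"
      using continuous_on_subset[OF cf sub] continuous_on_subset[OF g' sub]
      by (intro integrable_continuous_real continuous_intros)
    have i3: "?d integrable_on {x..y}"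
      using absolutely_integrable_on_subinterval[OF d sub] by (simp add: absolutely_integrable_on_def)
    have i4: "f' integrable_on {x..y}" "g' integrable_on {x..y}"
      using has_ac_deriv_integrable(2)[OF f xy] has_ac_deriv_integrable(2)[OF acg xy] by auto
    have "integral {0..y} ?d = integral {0..x} ?d + integral {x..y} ?d"
      using Henstock_Kurzweil_Integration.integral_combine[of 0 x y ?d] xy
        absolutely_integrable_on_subinterval[OF d, of 0 y] by (auto simp: absolutely_integrable_on_def)
    then have "\<Phi> y - \<Phi> x = (f y - f x) * g y + f x * (g y - g x) - integral {x..y} ?d"
      by (simp add: \<Phi>_def algebra_simps)
    also have "(f y - f x) * g y = integral {x..y} (\<lambda>t. f' t * g y)"
      using has_ac_deriv_diff[OF f xy] by simp
    also have "f x * (g y - g x) = integral {x..y} (\<lambda>t. f x * g' t)"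
      using has_ac_deriv_diff[OF acg xy] by simp
    also have "integral {x..y} (\<lambda>t. f' t * g y) + integral {x..y} (\<lambda>t. f x * g' t) - integral {x..y} ?d
        = integral {x..y} (\<lambda>t. (f' t * g y + f x * g' t) - ?d t)"
      using i3 i4 by (simp add: Henstock_Kurzweil_Integration.integral_add
          Henstock_Kurzweil_Integration.integral_diff integrable_on_mult_right integrable_on_mult_left
          Henstock_Kurzweil_Integration.integrable_add)
    also have "\<dots> = integral {x..y} (\<lambda>t. f' t * (g y - g t)) + integral {x..y} (\<lambda>t. (f x - f t) * g' t)"
      using i1 i2 by (simp add: Henstock_Kurzweil_Integration.integral_add[symmetric] algebra_simps)
    finally have "norm (\<Phi> y - \<Phi> x) \<le> norm (integral {x..y} (\<lambda>t. f' t * (g y - g t)))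
        + norm (integral {x..y} (\<lambda>t. (f x - f t) * g' t))"
      using norm_triangle_ineq by metis
    also have "norm (integral {x..y} (\<lambda>t. f' t * (g y - g t)))
        \<le> integral {x..y} (\<lambda>t. K * (y - x) * norm (f' t))"
    proof (rule integral_norm_bound_integral[OF i1])
      show "(\<lambda>t. K * (y - x) * norm (f' t)) integrable_on {x..y}"
        using has_ac_deriv_integrable(3)[OF f xy] by (intro integrable_on_mult_right)
      show "norm (f' t * (g y - g t)) \<le> K * (y - x) * norm (f' t)" if "t \<in> {x..y}" for t
        using lipschitz[of x t y] xy that
        by (simp add: norm_mult mult.commute[of "norm (f' t)"] mult_right_mono)
    qed
    also have "norm (integral {x..y} (\<lambda>t. (f x - f t) * g' t)) \<le> ((V y - V x) * K) * (y - x)"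
    proof (rule integral_bound)
      show "norm ((f x - f t) * g' t) \<le> (V y - V x) * K" if "t \<in> {x..y}" for t
        using f_diff[of x t y] K(2)[of t] that xy
        by (auto simp: norm_mult intro!: mult_mono intro: order_trans[OF norm_ge_zero])
    qed (use xy sub in \<open>auto intro!: continuous_intros continuous_on_subset[OF cf] continuous_on_subset[OF g']\<close>)
    also have "integral {x..y} (\<lambda>t. K * (y - x) * norm (f' t)) = K * (y - x) * (V y - V x)"
      by (simp only: V_diff[OF xy] Henstock_Kurzweil_Integration.integral_mult_right)
    finally show ?thesis by (simp add: algebra_simps)
  qed
  have sym: "norm (\<Phi> y - \<Phi> x) \<le> 2 * K * norm (y - x) * norm (V y - V x)"
    if "x \<in> {0..h}" "y \<in> {0..h}" for x y
  proof (cases "x \<le> y")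
    case True
    then have "V y - V x \<ge> 0" using f_diff[of x x y] that by auto
    then show ?thesis using estimate[of x y] that True by simp
  next
    case False
    then have "V x - V y \<ge> 0" using f_diff[of y y x] that by auto
    then show ?thesis using estimate[of y x] that False by (simp add: norm_minus_commute abs_minus_commute)
  qed
  have "(\<Phi> has_derivative (\<lambda>_. 0)) (at x within {0..h})" if x: "x \<in> {0..h}" for x
    unfolding has_derivative_iff_norm
  proof (intro conjI)
    have "((\<lambda>y. 2 * K * norm (V y - V x)) \<longlongrightarrow> 2 * K * norm (V x - V x)) (at x within {0..h})"
      using V_cont x by (intro tendsto_intros) (auto simp: continuous_on)
    then have lim: "((\<lambda>y. 2 * K * norm (V y - V x)) \<longlongrightarrow> 0) (at x within {0..h})"
      by simp
    show "((\<lambda>y. norm (\<Phi> y - \<Phi> x - 0) / norm (y - x)) \<longlongrightarrow> 0) (at x within {0..h})"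
    proof (rule Lim_null_comparison[OF _ lim])
      show "\<forall>\<^sub>F y in at x within {0..h}. norm (norm (\<Phi> y - \<Phi> x - 0) / norm (y - x)) \<le> 2 * K * norm (V y - V x)"
        unfolding eventually_at_filter
        by (rule always_eventually) (use sym x in \<open>auto simp: divide_le_eq algebra_simps\<close>)
    qed
  qed simp
  then obtain c where c: "\<And>x. x \<in> {0..h} \<Longrightarrow> \<Phi> x = c"
    using has_derivative_zero_constant[of "{0..h}" \<Phi>] by auto
  show ?thesis
    unfolding has_ac_deriv_def
  proof (intro conjI d ballI)
    fix x assume x: "x \<in> {0..h}"
    have "\<Phi> x = \<Phi> 0" using c[of x] c[of 0] x by simp
    then show "f x * g x = f 0 * g 0 + integral {0..x} ?d"
      by (simp add: \<Phi>_def algebra_simps)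
  qed
qed

section \<open>Weak derivatives and absolutely continuous representatives\<close>

lemma test_function_of_real_has_vector_derivative:
  assumes "test_function h \<phi>"
  shows "((\<lambda>x. complex_of_real (\<phi> x)) has_vector_derivative complex_of_real (deriv \<phi> x)) (at x within S)"
  using test_function_has_derivative[OF assms, of x]
  by (intro has_vector_derivative_of_real)
    (simp add: has_real_derivative_iff_has_vector_derivative has_vector_derivative_at_within)

text \<open>
  Integration by parts; the boundary terms vanish with the test function.
\<close>

lemma has_ac_deriv_imp_weak:
  assumes "h > 0" "has_ac_deriv h f g"
  shows "has_weak_deriv h f g"
  unfolding has_weak_deriv_def
proof (intro allI impI)
  fix \<phi> assume \<phi>: "test_function h \<phi>"
  let ?\<phi> = "\<lambda>x. complex_of_real (\<phi> x)" and ?\<phi>' = "\<lambda>x. complex_of_real (deriv \<phi> x)"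
  have c: "continuous_on {0..h} ?\<phi>" "continuous_on {0..h} ?\<phi>'"
    using \<phi> by (auto intro!: continuous_intros test_function_continuous test_function_deriv_continuous)
  have i: "(\<lambda>x. g x * ?\<phi> x) absolutely_integrable_on {0..h}" "(\<lambda>x. f x * ?\<phi>' x) absolutely_integrable_on {0..h}"
    by (intro absolutely_integrable_mult_continuous has_ac_deriv_absint[OF assms(2)] c,
        intro absolutely_integrable_continuous_real continuous_intros c has_ac_deriv_continuous[OF assms(2)])
  have "has_ac_deriv h (\<lambda>x. f x * ?\<phi> x) (\<lambda>x. g x * ?\<phi> x + f x * ?\<phi>' x)"
    by (rule has_ac_deriv_mult_C1[OF assms(2) test_function_of_real_has_vector_derivative[OF \<phi>] c(2)])
  then have "f h * ?\<phi> h - f 0 * ?\<phi> 0 = integral {0..h} (\<lambda>x. g x * ?\<phi> x + f x * ?\<phi>' x)"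
    using has_ac_deriv_diff[of h "\<lambda>x. f x * ?\<phi> x" _ 0 h] assms(1) by simp
  moreover have "\<phi> h = 0" "\<phi> 0 = 0"
    using test_functionE[OF \<phi> assms(1)] by fastforce+
  ultimately have "0 = integral {0..h} (\<lambda>x. g x * ?\<phi> x) + integral {0..h} (\<lambda>x. f x * ?\<phi>' x)"
    using i by (simp add: absolutely_integrable_on_def Henstock_Kurzweil_Integration.integral_add)
  then show "(LINT x|lebesgue_on {0<..<h}. f x * ?\<phi>' x) = - (LINT x|lebesgue_on {0<..<h}. g x * ?\<phi> x)"
    using i by (simp add: integral_lebesgue_on_Ioo eq_neg_iff_add_eq_0 add.commute)
qed

lemma L2_times_test_function_integrable:
  assumes "u \<in> L2 h" "test_function h \<phi>"
  shows "integrable (lebesgue_on {0<..<h}) (\<lambda>x. u x * complex_of_real (\<phi> x))"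
    "integrable (lebesgue_on {0<..<h}) (\<lambda>x. u x * complex_of_real (deriv \<phi> x))"
  using assms
  by (auto intro!: L2_imp_integrable L2_mult_continuous continuous_intros
      test_function_continuous test_function_deriv_continuous)

text \<open>
  Testing with bumps that converge to the indicator of $(a,b)$ shows that $u$ has integral $0$ over
  every compact subinterval. By Lebesgue's differentiation theorem $u$ is almost everywhere the limit
  of its mean values, hence $0$.
\<close>

lemma fundamental_lemma_of_variations:
  assumes "h > 0" "u \<in> L2 h"
    and orth: "\<And>\<phi>. test_function h \<phi> \<Longrightarrow> (LINT x|lebesgue_on {0<..<h}. u x * complex_of_real (\<phi> x)) = 0"
  shows "eq_L2 h u (\<lambda>x. 0)"
proof -
  let ?M = "lebesgue_on {0<..<h}"
  have zero: "integral {a..b} u = 0" if ab: "0 < a" "b < h" for a b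
  proof -
    let ?s = "\<lambda>n x. u x * complex_of_real (bump (real (Suc n)) a b x)"
    have test: "test_function h (bump (real (Suc n)) a b)" for n
      by (rule test_function_bump) (use ab in auto)
    have "(\<lambda>n. LINT x|?M. ?s n x) \<longlonglongrightarrow> (LINT x|?M. u x * complex_of_real (indicator {a<..<b} x))"
    proof (rule integral_dominated_convergence[where w = "\<lambda>x. cmod (u x)"])
      show "integrable ?M (\<lambda>x. cmod (u x))"
        using L2_imp_integrable[OF assms(2)] by simp
      show "?s n \<in> borel_measurable ?M" for n
        by (rule borel_measurable_integrable[OF L2_times_test_function_integrable(1)[OF assms(2) test]])
      have "{a<..<b} \<inter> {0<..<h} \<in> sets ?M"
        by (subst sets_restrict_space_iff) auto
      then have "(\<lambda>x. indicator {a<..<b} x :: real) \<in> borel_measurable ?M"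
        by (subst borel_measurable_indicator_iff) auto
      then show "(\<lambda>x. u x * complex_of_real (indicator {a<..<b} x)) \<in> borel_measurable ?M"
        using L2_measurable[OF assms(2)] by (intro borel_measurable_times borel_measurable_of_real) auto
      show "AE x in ?M. (\<lambda>n. ?s n x) \<longlonglongrightarrow> u x * complex_of_real (indicator {a<..<b} x)"
        by (intro AE_I2 tendsto_mult tendsto_const tendsto_of_real bump_tendsto_indicator)
      show "AE x in ?M. norm (?s n x) \<le> cmod (u x)" for n
        by (intro AE_I2) (simp add: norm_mult bump_nonneg mult_left_le bump_le_1)
    qed
    then have "(LINT x|?M. u x * complex_of_real (indicator {a<..<b} x)) = 0"
      by (simp only: orth[OF test] LIMSEQ_const_iff)
    moreover have "(LINT x|?M. u x * complex_of_real (indicator {a<..<b} x)) = integral {a..b} u"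
    proof -
      have "(LINT x|?M. u x * complex_of_real (indicator {a<..<b} x))
          = (LINT x|lebesgue. indicator {a<..<b} x *\<^sub>R u x)"
        using ab by (subst integral_restrict_space)
          (auto intro!: Bochner_Integration.integral_cong simp: indicator_def)
      also have "\<dots> = (LINT x|lebesgue_on {a<..<b}. u x)"
        by (subst integral_restrict_space) auto
      also have "\<dots> = integral {a..b} u"
        using ab by (intro integral_lebesgue_on_Ioo
            absolutely_integrable_on_subinterval[OF L2_imp_absolutely_integrable[OF assms(2)]]) auto
      finally show ?thesis .
    qed
    ultimately show ?thesis by simp
  qed
  \<comment> \<open>The differentiation theorem is about functions that are integrable on every interval of the line.\<close>
  define v where "v x = (if x \<in> {0..h} then u x else 0)" for x
  have "v absolutely_integrable_on UNIV"
    unfolding v_def absolutely_integrable_restrict_UNIV by (rule L2_imp_absolutely_integrable[OF assms(2)])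
  then have "v integrable_on cbox a b" for a b
    using absolutely_integrable_on_subcbox[where f = v and S = UNIV and a = a and b = b] by (auto simp: absolutely_integrable_on_def)
  then obtain N where N: "negligible N" "\<And>x e. \<lbrakk>x \<notin> N; 0 < e\<rbrakk> \<Longrightarrow>
      \<exists>d>0. \<forall>k. 0 < k \<and> k < d \<longrightarrow> norm (integral (cbox x (x + k *\<^sub>R One)) v /\<^sub>R k ^ DIM(real) - v x) < e"
    using integrable_ccontinuous_explicit[of v] by blast
  have "u x = 0" if x: "x \<in> {0<..<h}" "x \<notin> N" for x
  proof (rule ccontr)
    assume "u x \<noteq> 0"
    then obtain d where d: "d > 0" "\<And>k. 0 < k \<Longrightarrow> k < d \<Longrightarrow>
        norm (integral {x..x + k} v /\<^sub>R k - v x) < norm (u x)"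
      using N(2)[of x "norm (u x)"] x by auto
    define k where "k = min (d / 2) ((h - x) / 2)"
    have k: "0 < k" "k < d" "x + k < h"
      using d x by (auto simp: k_def min_def field_simps)
    have "integral {x..x + k} v = integral {x..x + k} u"
      by (rule integral_cong) (use x k in \<open>auto simp: v_def\<close>)
    then have "integral {x..x + k} v = 0" using zero[of x "x + k"] x k by auto
    then show False using d(2)[OF k(1,2)] x by (simp add: v_def)
  qed
  then have "{x. \<not> (x \<in> {0<..<h} \<longrightarrow> u x = 0)} \<subseteq> N" by auto
  then have "AE x in lebesgue. x \<in> {0<..<h} \<longrightarrow> u x = 0"
    unfolding eventually_ae_filter_negligible using N(1) by blast
  then show ?thesis
    unfolding eq_L2_def by (subst AE_restrict_space_iff) auto
qed

lemma has_weak_deriv_diff: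
  assumes "f1 \<in> L2 h" "f2 \<in> L2 h" "g1 \<in> L2 h" "g2 \<in> L2 h"
    "has_weak_deriv h f1 g1" "has_weak_deriv h f2 g2"
  shows "has_weak_deriv h (\<lambda>x. f1 x - f2 x) (\<lambda>x. g1 x - g2 x)"
  using assms unfolding has_weak_deriv_def
  by (simp add: left_diff_distrib Bochner_Integration.integral_diff L2_times_test_function_integrable)

lemma L2_diff: "f \<in> L2 h \<Longrightarrow> g \<in> L2 h \<Longrightarrow> (\<lambda>x. f x - g x) \<in> L2 h"
  using L2_lincomb[of f h g 1 "-1"] by simp

lemma eq_L2_diff_0: "eq_L2 h (\<lambda>x. f x - g x) (\<lambda>x. 0) \<longleftrightarrow> eq_L2 h f g"
  by (simp add: eq_L2_def)

lemma weak_deriv_unique: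
  assumes "h > 0" "g1 \<in> L2 h" "g2 \<in> L2 h" "has_weak_deriv h f g1" "has_weak_deriv h f g2"
  shows "eq_L2 h g1 g2"
proof -
  have "eq_L2 h (\<lambda>x. g1 x - g2 x) (\<lambda>x. 0)"
  proof (rule fundamental_lemma_of_variations[OF assms(1) L2_diff[OF assms(2,3)]])
    fix \<phi> assume \<phi>: "test_function h \<phi>"
    then show "(LINT x|lebesgue_on {0<..<h}. (g1 x - g2 x) * complex_of_real (\<phi> x)) = 0"
      using assms unfolding has_weak_deriv_def
      by (simp add: left_diff_distrib Bochner_Integration.integral_diff L2_times_test_function_integrable)
  qed
  then show ?thesis by (simp add: eq_L2_diff_0)
qed

text \<open>
  A test function $\psi$ is a derivative of a test function once its mean is removed by subtracting
  $(\int \psi)\, \rho$, where $\rho$ has integral $1$. Therefore $\int w \psi = c \int \psi$ with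
  $c = \int w \rho$, and $w - c$ is orthogonal to all test functions.
\<close>

lemma weak_deriv_zero_imp_const:
  assumes "h > 0" "w \<in> L2 h" "has_weak_deriv h w (\<lambda>x. 0)"
  obtains c where "eq_L2 h w (\<lambda>x. c)"
proof -
  let ?M = "lebesgue_on {0<..<h}"
  obtain \<rho> where \<rho>: "test_function h \<rho>" "integral {0..h} \<rho> = 1"
    using test_function_unit_integral[OF assms(1)] by blast
  define c where "c = (LINT x|?M. w x * complex_of_real (\<rho> x))"
  have "eq_L2 h (\<lambda>x. w x - c) (\<lambda>x. 0)"
  proof (rule fundamental_lemma_of_variations[OF assms(1)])
    show cL2: "(\<lambda>x. w x - c) \<in> L2 h"
      by (intro L2_diff assms continuous_imp_L2 continuous_intros)
    fix \<psi> assume \<psi>: "test_function h \<psi>"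
    define m where "m = integral {0..h} \<psi>"
    have ai: "\<psi> absolutely_integrable_on {0..h}" "\<rho> absolutely_integrable_on {0..h}"
      using \<psi> \<rho> by (auto intro!: absolutely_integrable_continuous_real test_function_continuous)
    have "test_function h (\<lambda>x. \<psi> x + (- m) * \<rho> x)"
    proof -
      obtain a b where ab: "0 < a" "a \<le> b" "b < h" "\<And>x. x \<notin> {a..b} \<Longrightarrow> \<psi> x = 0"
        using test_functionE[OF \<psi> assms(1)] by blast
      obtain a' b' where ab': "0 < a'" "a' \<le> b'" "b' < h" "\<And>x. x \<notin> {a'..b'} \<Longrightarrow> \<rho> x = 0"
        using test_functionE[OF \<rho>(1) assms(1)] by blast
      show ?thesis
      proof (rule test_functionI)
        show "\<psi> x + (- m) * \<rho> x = 0" if "x \<notin> {min a a'..max b b'}" for x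
          using ab(4)[of x] ab'(4)[of x] that by (auto simp: min_def max_def split: if_splits)
        show "differentiable_times n (\<lambda>x. \<psi> x + (- m) * \<rho> x)" for n
          by (intro differentiable_times_add differentiable_times_mult differentiable_times_const
              test_function_differentiable_times[OF \<psi>] test_function_differentiable_times[OF \<rho>(1)])
      qed (use ab ab' in auto)
    qed
    moreover have "integral {0..h} (\<lambda>x. \<psi> x + (- m) * \<rho> x) = 0"
      using ai \<rho>(2) m_def integrable_on_mult_right[of \<rho> "{0..h}" m]
      by (simp add: absolutely_integrable_on_def Henstock_Kurzweil_Integration.integral_diff)
    ultimately obtain \<phi> where \<phi>: "test_function h \<phi>" "deriv \<phi> = (\<lambda>x. \<psi> x + (- m) * \<rho> x)"
      using test_function_primitive[OF _ assms(1)] by blast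
    have "(LINT x|?M. w x * complex_of_real (\<psi> x + (- m) * \<rho> x)) = 0"
      using assms(3)[unfolded has_weak_deriv_def, rule_format, OF \<phi>(1)] by (simp add: \<phi>(2))
    also have "(\<lambda>x. w x * complex_of_real (\<psi> x + (- m) * \<rho> x))
        = (\<lambda>x. w x * complex_of_real (\<psi> x) - m * (w x * complex_of_real (\<rho> x)))"
      by (auto simp: algebra_simps)
    finally have 1: "(LINT x|?M. w x * complex_of_real (\<psi> x)) = m * c"
      using L2_times_test_function_integrable(1)[OF assms(2) \<psi>]
        L2_times_test_function_integrable(1)[OF assms(2) \<rho>(1)]
      by (simp add: c_def)
    have 2: "integrable ?M \<psi>" using ai integrable_lebesgue_on_Ioo_iff by blast
    have "(LINT x|?M. \<psi> x) = m"
      unfolding m_def by (rule integral_lebesgue_on_Ioo[OF ai(1)])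
    then have "(LINT x|?M. complex_of_real (\<psi> x)) = complex_of_real m" by simp
    then show "(LINT x|?M. (w x - c) * complex_of_real (\<psi> x)) = 0"
      using 1 2 L2_times_test_function_integrable(1)[OF assms(2) \<psi>]
      by (simp add: left_diff_distrib)
  qed
  then show ?thesis using that[of c] by (simp add: eq_L2_diff_0)
qed

lemma weak_imp_ac_representative:
  assumes "h > 0" "f \<in> L2 h" "g \<in> L2 h" "has_weak_deriv h f g"
  obtains F where "has_ac_deriv h F g" "eq_L2 h f F"
proof -
  define G where "G x = 0 + integral {0..x} g" for x
  have G: "has_ac_deriv h G g"
    unfolding G_def by (rule has_ac_deriv_integral[OF L2_imp_absolutely_integrable[OF assms(3)]])
  have GL2: "G \<in> L2 h" by (rule continuous_imp_L2[OF has_ac_deriv_continuous[OF G]])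
  have "has_weak_deriv h (\<lambda>x. f x - G x) (\<lambda>x. g x - g x)"
    by (rule has_weak_deriv_diff[OF assms(2) GL2 assms(3) assms(3) assms(4) has_ac_deriv_imp_weak[OF assms(1) G]])
  then obtain c where "eq_L2 h (\<lambda>x. f x - G x) (\<lambda>x. c)"
    using weak_deriv_zero_imp_const[OF assms(1) L2_diff[OF assms(2) GL2]] by auto
  then have "eq_L2 h f (\<lambda>x. c + integral {0..x} g)"
    unfolding eq_L2_def by eventually_elim (simp add: G_def algebra_simps)
  then show ?thesis
    using that[OF has_ac_deriv_integral[OF L2_imp_absolutely_integrable[OF assms(3)]]] by blast
qed

section \<open>The domain of the operator in terms of continuous representatives\<close>

lemma has_weak_deriv_cong:
  assumes "f1 \<in> L2 h" "f2 \<in> L2 h" "eq_L2 h f1 f2"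
  shows "has_weak_deriv h f1 g \<longleftrightarrow> has_weak_deriv h f2 g"
proof -
  have "(LINT x|lebesgue_on {0<..<h}. f1 x * complex_of_real (deriv \<phi> x)) =
      (LINT x|lebesgue_on {0<..<h}. f2 x * complex_of_real (deriv \<phi> x))" if "test_function h \<phi>" for \<phi>
  proof (rule integral_cong_AE)
    show "AE x in lebesgue_on {0<..<h}. f1 x * complex_of_real (deriv \<phi> x) = f2 x * complex_of_real (deriv \<phi> x)"
      using assms(3) unfolding eq_L2_def by eventually_elim simp
  qed (intro borel_measurable_integrable[OF L2_times_test_function_integrable(2)] assms that)+
  then show ?thesis unfolding has_weak_deriv_def by simp
qed

lemma H1_weak_deriv:
  assumes "f \<in> H1 h"
  shows "weak_deriv h f \<in> L2 h" "has_weak_deriv h f (weak_deriv h f)"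
proof -
  have "\<exists>g. g \<in> L2 h \<and> has_weak_deriv h f g" using assms by (auto simp: H1_def)
  from someI_ex[OF this] show "weak_deriv h f \<in> L2 h" "has_weak_deriv h f (weak_deriv h f)"
    by (simp_all add: weak_deriv_def)
qed

lemma ac_representative_imp_H1:
  assumes "h > 0" "f \<in> L2 h" "eq_L2 h f F" "has_ac_deriv h F g" "g \<in> L2 h"
  shows "f \<in> H1 h" "eq_L2 h (weak_deriv h f) g"
proof -
  have "has_weak_deriv h f g"
    using has_weak_deriv_cong[OF assms(2) continuous_imp_L2[OF has_ac_deriv_continuous[OF assms(4)]] assms(3)]
      has_ac_deriv_imp_weak[OF assms(1,4)] by simp
  then show H1: "f \<in> H1 h" using assms by (auto simp: H1_def)
  show "eq_L2 h (weak_deriv h f) g"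
    using weak_deriv_unique[OF assms(1) H1_weak_deriv(1)[OF H1] assms(5) H1_weak_deriv(2)[OF H1]]
      \<open>has_weak_deriv h f g\<close> by blast
qed

text \<open>
  $P$ is the continuously differentiable representative of $p$; its derivative $P'$ is absolutely
  continuous, and the boundary conditions hold pointwise. The element $p$ belongs to the domain of
  $L$ exactly if it has such data (\<open>dom_L_imp_rep\<close> and \<open>dom_rep_weak_deriv\<close>); then $L p$ is
  $P'' + P$ almost everywhere.
\<close>

definition dom_rep ::
    "real \<Rightarrow> (real \<Rightarrow> complex) \<Rightarrow> (real \<Rightarrow> complex) \<Rightarrow> (real \<Rightarrow> complex) \<Rightarrow> (real \<Rightarrow> complex) \<Rightarrow> bool" where
  "dom_rep h p P P' P'' \<longleftrightarrow> p \<in> L2 h \<and> eq_L2 h p P \<and> has_ac_deriv h P P' \<and>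
     has_ac_deriv h P' P'' \<and> P'' \<in> L2 h \<and> P' 0 = 0 \<and> P h = 0"

lemma dom_rep_continuous:
  assumes "dom_rep h p P P' P''"
  shows "continuous_on {0..h} P" "continuous_on {0..h} P'"
  using assms has_ac_deriv_continuous unfolding dom_rep_def by blast+

lemma dom_L_imp_rep:
  assumes "h > 0" "p \<in> dom_L h"
  obtains P P' P'' where "dom_rep h p P P' P''"
proof -
  have p: "p \<in> H1 h" "weak_deriv h p \<in> H1 h" "p \<in> L2 h"
    using assms(2) by (auto simp: dom_L_def H2_def H1_def)
  obtain P where P: "has_ac_deriv h P (weak_deriv h p)" "eq_L2 h p P"
    using weak_imp_ac_representative[OF assms(1) p(3) H1_weak_deriv[OF p(1)]] by blast
  obtain P' where P': "has_ac_deriv h P' (weak_deriv h (weak_deriv h p))" "eq_L2 h (weak_deriv h p) P'"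
    using weak_imp_ac_representative[OF assms(1) H1_weak_deriv(1)[OF p(1)] H1_weak_deriv[OF p(2)]] by blast
  have cont: "continuous_on {0..h} P" "continuous_on {0..h} P'"
    using P(1) P'(1) has_ac_deriv_continuous by blast+
  \<comment> \<open>The derivative of $P$ is only known as the chosen weak derivative; its continuous representative is equal to it almost everywhere.\<close>
  have ac: "has_ac_deriv h P P'"
    using P(1) P'(2) absolutely_integrable_continuous_real[OF cont(2)] by (rule has_ac_deriv_eq_L2)
  obtain g where g: "continuous_on {0..h} g" "eq_L2 h (weak_deriv h p) g" "g 0 = 0"
    using assms(2) by (auto simp: dom_L_def has_boundary_value_def)
  have "P' 0 = g 0"
    using eq_L2_continuous_unique[OF assms(1) cont(2) g(1) eq_L2_trans[OF eq_L2_sym[OF P'(2)] g(2)]] assms(1) by simp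
  moreover obtain k where k: "continuous_on {0..h} k" "eq_L2 h p k" "k h = 0"
    using assms(2) by (auto simp: dom_L_def has_boundary_value_def)
  have "P h = k h"
    using eq_L2_continuous_unique[OF assms(1) cont(1) k(1) eq_L2_trans[OF eq_L2_sym[OF P(2)] k(2)]] assms(1) by simp
  ultimately have "dom_rep h p P P' (weak_deriv h (weak_deriv h p))"
    using p P P' ac g k H1_weak_deriv(1)[OF p(2)] by (simp add: dom_rep_def)
  then show ?thesis by (rule that)
qed

lemma dom_rep_weak_deriv:
  assumes "h > 0" "dom_rep h p P P' P''"
  shows "p \<in> dom_L h" "eq_L2 h (weak_deriv h p) P'" "eq_L2 h (weak_deriv h (weak_deriv h p)) P''"
    "weak_deriv h p \<in> L2 h" "weak_deriv h (weak_deriv h p) \<in> L2 h"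
proof -
  note d = assms(2)[unfolded dom_rep_def]
  note c = dom_rep_continuous[OF assms(2)]
  have 1: "p \<in> H1 h" "eq_L2 h (weak_deriv h p) P'"
    using ac_representative_imp_H1[OF assms(1), of p P P'] d continuous_imp_L2[OF c(2)] by blast+
  have 2: "weak_deriv h p \<in> H1 h" "eq_L2 h (weak_deriv h (weak_deriv h p)) P''"
    using ac_representative_imp_H1[OF assms(1) H1_weak_deriv(1)[OF 1(1)] 1(2)] d by blast+
  show "p \<in> dom_L h"
    using 1 2 d c by (auto simp: dom_L_def H2_def has_boundary_value_def)
  show "eq_L2 h (weak_deriv h p) P'" "eq_L2 h (weak_deriv h (weak_deriv h p)) P''"
    by (fact 1 2)+
  show "weak_deriv h p \<in> L2 h" "weak_deriv h (weak_deriv h p) \<in> L2 h"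
    using 1 2 H1_weak_deriv by blast+
qed

lemma eq_L2_lincomb:
  "eq_L2 h f F \<Longrightarrow> eq_L2 h g G \<Longrightarrow> eq_L2 h (\<lambda>x. a * f x + b * g x) (\<lambda>x. a * F x + b * G x)"
  unfolding eq_L2_def by (auto elim: eventually_elim2)

lemma eq_L2_mult: "eq_L2 h f F \<Longrightarrow> eq_L2 h (\<lambda>x. f x * g x) (\<lambda>x. F x * g x)"
  unfolding eq_L2_def by (auto elim: eventually_mono)

lemma dom_rep_lincomb:
  assumes "dom_rep h p P P' P''" "dom_rep h q Q Q' Q''"
  shows "dom_rep h (\<lambda>x. a * p x + b * q x) (\<lambda>x. a * P x + b * Q x)
    (\<lambda>x. a * P' x + b * Q' x) (\<lambda>x. a * P'' x + b * Q'' x)"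
  using assms unfolding dom_rep_def
  by (auto intro: L2_lincomb has_ac_deriv_lincomb eq_L2_lincomb)

lemma shift_op_rep:
  assumes "h > 0" "dom_rep h p P P' P''"
  shows "shift_op (op_L h) l p \<in> L2 h"
    "eq_L2 h (shift_op (op_L h) l p) (\<lambda>x. P'' x + (1 - l) * P x)"
    "(\<lambda>x. P'' x + (1 - l) * P x) \<in> L2 h"
proof -
  note d = assms(2)[unfolded dom_rep_def] and w = dom_rep_weak_deriv[OF assms]
  have eq: "shift_op (op_L h) l p = (\<lambda>x. 1 * weak_deriv h (weak_deriv h p) x + (1 - l) * p x)"
    by (auto simp: shift_op_def op_L_def algebra_simps)
  show "shift_op (op_L h) l p \<in> L2 h"
    unfolding eq using w d by (intro L2_lincomb) auto
  show "eq_L2 h (shift_op (op_L h) l p) (\<lambda>x. P'' x + (1 - l) * P x)"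
    using eq_L2_lincomb[of h "weak_deriv h (weak_deriv h p)" P'' p P 1 "1 - l"] w d unfolding eq by simp
  show "(\<lambda>x. P'' x + (1 - l) * P x) \<in> L2 h"
    using L2_lincomb[of P'' h P 1 "1 - l"] d continuous_imp_L2[OF dom_rep_continuous(1)[OF assms(2)]] by simp
qed

section \<open>The initial value problem\<close>

definition cos_sol :: "complex \<Rightarrow> real \<Rightarrow> complex" where
  "cos_sol w x = cos (w * of_real x)"

definition sin_sol :: "complex \<Rightarrow> real \<Rightarrow> complex" where
  "sin_sol w x = (if w = 0 then of_real x else sin (w * of_real x) / w)"

lemma cos_sol_0 [simp]: "cos_sol w 0 = 1" and sin_sol_0 [simp]: "sin_sol w 0 = 0"
  by (simp_all add: cos_sol_def sin_sol_def)

lemma cos_sol_deriv: "(cos_sol w has_vector_derivative - (w\<^sup>2) * sin_sol w x) (at x within S)"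
proof -
  have "((\<lambda>z. cos (w * z)) has_field_derivative - (w\<^sup>2) * sin_sol w x) (at (of_real x))"
    by (auto intro!: derivative_eq_intros simp: sin_sol_def power2_eq_square)
  then show ?thesis
    using has_vector_derivative_real_field unfolding cos_sol_def by blast
qed

lemma sin_sol_deriv: "(sin_sol w has_vector_derivative cos_sol w x) (at x within S)"
proof -
  have "((\<lambda>z. if w = 0 then z else sin (w * z) / w) has_field_derivative cos_sol w x) (at (of_real x))"
    by (cases "w = 0") (auto intro!: derivative_eq_intros simp: cos_sol_def)
  then show ?thesis
    using has_vector_derivative_real_field unfolding sin_sol_def by blast
qed

lemma cos_sol_continuous: "continuous_on S (cos_sol w)"
  by (rule continuous_on_vector_derivative[OF cos_sol_deriv])

lemma sin_sol_continuous: "continuous_on S (sin_sol w)"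
  by (rule continuous_on_vector_derivative[OF sin_sol_deriv])

lemma cos_sol_sin_sol: "(cos_sol w x)\<^sup>2 + w\<^sup>2 * (sin_sol w x)\<^sup>2 = 1"
  by (auto simp: cos_sol_def sin_sol_def power_divide sin_squared_eq)

lemma has_ac_deriv_mult_cos_sol:
  "has_ac_deriv h f f' \<Longrightarrow> has_ac_deriv h (\<lambda>x. f x * cos_sol w x) (\<lambda>x. f' x * cos_sol w x + f x * (- (w\<^sup>2) * sin_sol w x))"
  by (intro has_ac_deriv_mult_C1 cos_sol_deriv continuous_intros sin_sol_continuous)

lemma has_ac_deriv_mult_sin_sol:
  "has_ac_deriv h f f' \<Longrightarrow> has_ac_deriv h (\<lambda>x. f x * sin_sol w x) (\<lambda>x. f' x * sin_sol w x + f x * cos_sol w x)"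
  by (intro has_ac_deriv_mult_C1 sin_sol_deriv cos_sol_continuous)

text \<open>
  The two functions $P' C + w^2 P S$ and $P' S - P C$ have the derivatives $f C$ and $f S$. Integrating
  from $0$ and solving the linear system for $P$, whose determinant is $-(C^2 + w^2 S^2) = -1$, gives the
  formula.
\<close>

lemma variation_of_constants:
  fixes w :: complex
  assumes P: "has_ac_deriv h P P'" and P': "has_ac_deriv h P' P''" and "P' 0 = 0" and x: "0 \<le> x" "x \<le> h"
  defines "f \<equiv> \<lambda>x. P'' x + w\<^sup>2 * P x"
  shows "P x = P 0 * cos_sol w x + sin_sol w x * integral {0..x} (\<lambda>t. f t * cos_sol w t)
           - cos_sol w x * integral {0..x} (\<lambda>t. f t * sin_sol w t)"
proof -
  let ?C = "cos_sol w" and ?S = "sin_sol w"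
  have "has_ac_deriv h (\<lambda>x. 1 * (P' x * ?C x) + w\<^sup>2 * (P x * ?S x))
      (\<lambda>x. 1 * (P'' x * ?C x + P' x * (- (w\<^sup>2) * ?S x)) + w\<^sup>2 * (P' x * ?S x + P x * ?C x))"
    by (intro has_ac_deriv_lincomb has_ac_deriv_mult_cos_sol has_ac_deriv_mult_sin_sol P P')
  also have "(\<lambda>x. 1 * (P'' x * ?C x + P' x * (- (w\<^sup>2) * ?S x)) + w\<^sup>2 * (P' x * ?S x + P x * ?C x))
      = (\<lambda>x. f x * ?C x)"
    by (auto simp: f_def algebra_simps)
  finally have 1: "P' x * ?C x + w\<^sup>2 * (P x * ?S x) = integral {0..x} (\<lambda>t. f t * ?C t)"
    using has_ac_deriv_diff[of h _ _ 0 x] x \<open>P' 0 = 0\<close> by fastforce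
  have "has_ac_deriv h (\<lambda>x. P' x * ?S x - P x * ?C x)
      (\<lambda>x. (P'' x * ?S x + P' x * ?C x) - (P' x * ?C x + P x * (- (w\<^sup>2) * ?S x)))"
    by (intro has_ac_deriv_minus has_ac_deriv_mult_cos_sol has_ac_deriv_mult_sin_sol P P')
  also have "(\<lambda>x. (P'' x * ?S x + P' x * ?C x) - (P' x * ?C x + P x * (- (w\<^sup>2) * ?S x))) = (\<lambda>x. f x * ?S x)"
    by (auto simp: f_def algebra_simps)
  finally have 2: "P' x * ?S x - P x * ?C x + P 0 = integral {0..x} (\<lambda>t. f t * ?S t)"
    using has_ac_deriv_diff[of h _ _ 0 x] x \<open>P' 0 = 0\<close> by fastforce
  have "P 0 * ?C x + ?S x * (P' x * ?C x + w\<^sup>2 * (P x * ?S x)) - ?C x * (P' x * ?S x - P x * ?C x + P 0)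
      = P x * ((?C x)\<^sup>2 + w\<^sup>2 * (?S x)\<^sup>2)"
    by (simp add: algebra_simps power2_eq_square)
  then show ?thesis unfolding 1 2 by (simp add: cos_sol_sin_sol)
qed

lemma L2_mult_sol:
  assumes "f \<in> L2 h"
  shows "(\<lambda>x. f x * cos_sol w x) \<in> L2 h" "(\<lambda>x. f x * sin_sol w x) \<in> L2 h"
  using assms by (auto intro: L2_mult_continuous cos_sol_continuous sin_sol_continuous)

lemma boundary_value_problem_solvable:
  assumes "h > 0" "f \<in> L2 h" "cos_sol w h \<noteq> 0"
  obtains Q Q' where "dom_rep h Q Q Q' (\<lambda>x. f x - w\<^sup>2 * Q x)"
proof -
  let ?C = "cos_sol w" and ?S = "sin_sol w"
  define A where "A x = 0 + integral {0..x} (\<lambda>t. f t * ?C t)" for x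
  define B where "B x = 0 + integral {0..x} (\<lambda>t. f t * ?S t)" for x
  have A: "has_ac_deriv h A (\<lambda>t. f t * ?C t)" and B: "has_ac_deriv h B (\<lambda>t. f t * ?S t)"
    unfolding A_def B_def
    by (intro has_ac_deriv_integral L2_imp_absolutely_integrable L2_mult_sol assms(2))+
  \<comment> \<open>The value at $0$ for which the solution vanishes at $h$.\<close>
  define k where "k = - (A h * ?S h - B h * ?C h) / ?C h"
  define Q where "Q x = k * ?C x + 1 * (A x * ?S x - B x * ?C x)" for x
  \<comment> \<open>The terms $f C S$ cancel in the derivative of $Q$, which is therefore absolutely continuous.\<close>
  define Q' where "Q' x = (- k * w\<^sup>2) * ?S x + 1 * (1 * (A x * ?C x) + w\<^sup>2 * (B x * ?S x))" for x
  have acC: "has_ac_deriv h ?C (\<lambda>x. - (w\<^sup>2) * ?S x)" and acS: "has_ac_deriv h ?S ?C"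
    by (intro has_ac_deriv_C1 cos_sol_deriv sin_sol_deriv continuous_intros cos_sol_continuous sin_sol_continuous)+
  have "has_ac_deriv h Q (\<lambda>x. k * (- (w\<^sup>2) * ?S x)
      + 1 * ((f x * ?C x * ?S x + A x * ?C x) - (f x * ?S x * ?C x + B x * (- (w\<^sup>2) * ?S x))))"
    unfolding Q_def
    by (intro has_ac_deriv_lincomb has_ac_deriv_minus has_ac_deriv_mult_cos_sol has_ac_deriv_mult_sin_sol A B acC acS)
  also have "(\<lambda>x. k * (- (w\<^sup>2) * ?S x)
      + 1 * ((f x * ?C x * ?S x + A x * ?C x) - (f x * ?S x * ?C x + B x * (- (w\<^sup>2) * ?S x)))) = Q'"
    by (auto simp: Q'_def algebra_simps)
  finally have Q: "has_ac_deriv h Q Q'" .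
  have "has_ac_deriv h Q' (\<lambda>x. (- k * w\<^sup>2) * ?C x
      + 1 * (1 * (f x * ?C x * ?C x + A x * (- (w\<^sup>2) * ?S x)) + w\<^sup>2 * (f x * ?S x * ?S x + B x * ?C x)))"
    unfolding Q'_def
    by (intro has_ac_deriv_lincomb has_ac_deriv_mult_cos_sol has_ac_deriv_mult_sin_sol A B acC acS)
  also have "(\<lambda>x. (- k * w\<^sup>2) * ?C x
      + 1 * (1 * (f x * ?C x * ?C x + A x * (- (w\<^sup>2) * ?S x)) + w\<^sup>2 * (f x * ?S x * ?S x + B x * ?C x)))
      = (\<lambda>x. f x - w\<^sup>2 * Q x)"
  proof
    fix x
    have "(- k * w\<^sup>2) * ?C x
      + 1 * (1 * (f x * ?C x * ?C x + A x * (- (w\<^sup>2) * ?S x)) + w\<^sup>2 * (f x * ?S x * ?S x + B x * ?C x))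
      = f x * ((?C x)\<^sup>2 + w\<^sup>2 * (?S x)\<^sup>2) - w\<^sup>2 * Q x"
      by (simp add: Q_def algebra_simps power2_eq_square)
    then show "(- k * w\<^sup>2) * ?C x
      + 1 * (1 * (f x * ?C x * ?C x + A x * (- (w\<^sup>2) * ?S x)) + w\<^sup>2 * (f x * ?S x * ?S x + B x * ?C x))
      = f x - w\<^sup>2 * Q x"
      by (simp only: cos_sol_sin_sol mult_1_right)
  qed
  finally have Q': "has_ac_deriv h Q' (\<lambda>x. f x - w\<^sup>2 * Q x)" .
  have QL2: "Q \<in> L2 h" by (rule continuous_imp_L2[OF has_ac_deriv_continuous[OF Q]])
  have "dom_rep h Q Q Q' (\<lambda>x. f x - w\<^sup>2 * Q x)"
    unfolding dom_rep_def
  proof (intro conjI Q Q' QL2 eq_L2_refl)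
    show "(\<lambda>x. f x - w\<^sup>2 * Q x) \<in> L2 h"
      using L2_lincomb[OF assms(2) QL2, of 1 "- (w\<^sup>2)"] by simp
    show "Q' 0 = 0" by (simp add: Q'_def A_def)
    show "Q h = 0" using assms(3) by (simp add: Q_def k_def)
  qed
  then show ?thesis by (rule that)
qed

section \<open>Resolvent set and eigenvalues\<close>

lemma norm_integral_mult_le:
  assumes "f \<in> L2 h" "continuous_on {0..h} g" "\<And>x. x \<in> {0..h} \<Longrightarrow> cmod (g x) \<le> K" "0 \<le> x" "x \<le> h"
  shows "cmod (integral {0..x} (\<lambda>t. f t * g t)) \<le> K * integral {0..h} (\<lambda>t. cmod (f t))"
proof -
  have sub: "{0..x} \<subseteq> {0..h}" using assms by auto
  have i1: "(\<lambda>t. f t * g t) integrable_on {0..x}"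
    using absolutely_integrable_on_subinterval[OF L2_imp_absolutely_integrable[OF L2_mult_continuous[OF assms(1,2)]] sub]
    by (simp add: absolutely_integrable_on_def)
  have i2: "(\<lambda>t. cmod (f t)) integrable_on {0..x}" "(\<lambda>t. cmod (f t)) integrable_on {0..h}"
    using absolutely_integrable_on_subinterval[OF L2_imp_absolutely_integrable[OF assms(1)] sub]
      L2_imp_absolutely_integrable[OF assms(1)] by (simp_all add: absolutely_integrable_on_def)
  have "0 \<le> K" using order_trans[OF norm_ge_zero assms(3)[of 0]] assms(4,5) by simp
  have "cmod (integral {0..x} (\<lambda>t. f t * g t)) \<le> integral {0..x} (\<lambda>t. K * cmod (f t))"
    using i2(1) sub assms(3)
    by (intro integral_norm_bound_integral[OF i1] integrable_on_mult_right)
      (auto simp: norm_mult mult.commute[of "cmod (f _)"] intro!: mult_right_mono)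
  also have "\<dots> = K * integral {0..x} (\<lambda>t. cmod (f t))"
    by (rule Henstock_Kurzweil_Integration.integral_mult_right)
  also have "\<dots> \<le> K * integral {0..h} (\<lambda>t. cmod (f t))"
    by (intro mult_left_mono \<open>0 \<le> K\<close> integral_subset_le sub i2) auto
  finally show ?thesis .
qed

lemma homogeneous_solution:
  assumes "h > 0" "dom_rep h p P P' P''" "eq_L2 h (\<lambda>x. P'' x + w\<^sup>2 * P x) (\<lambda>x. 0)" "0 \<le> x" "x \<le> h"
  shows "P x = P 0 * cos_sol w x"
proof -
  have "integral {0..x} (\<lambda>t. (P'' t + w\<^sup>2 * P t) * g t) = 0" for g
    using eq_L2_integral[OF eq_L2_mult[OF assms(3), of g] assms(5)] by simp
  then show ?thesis
    using variation_of_constants[of h P P' P'' x w] assms by (simp add: dom_rep_def)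
qed

text \<open>
  The condition $p(h) = 0$ fixes $p(0)$ in the formula of \<open>variation_of_constants\<close>. This gives
  injectivity and the bound on the inverse: with $N$ the integral of $|f|$, the particular solution
  is at most $2 K_1 K_2 N$, where $K_1$ and $K_2$ bound $C$ and $S$ on $[0,h]$.
\<close>

lemma in_resolvent_set:
  assumes "h > 0" "w\<^sup>2 = 1 - l" "cos_sol w h \<noteq> 0"
  shows "l \<in> resolvent_set h (dom_L h) (op_L h)"
  unfolding resolvent_set_def
proof (intro CollectI conjI ballI impI)
  fix p q assume pq: "p \<in> dom_L h" "q \<in> dom_L h"
    and eq: "eq_L2 h (shift_op (op_L h) l p) (shift_op (op_L h) l q)"
  obtain P P' P'' where P: "dom_rep h p P P' P''" using dom_L_imp_rep[OF assms(1) pq(1)] .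
  obtain Q Q' Q'' where Q: "dom_rep h q Q Q' Q''" using dom_L_imp_rep[OF assms(1) pq(2)] .
  note R = dom_rep_lincomb[OF P Q, of 1 "-1"]
  have "eq_L2 h (\<lambda>x. P'' x + (1 - l) * P x) (\<lambda>x. Q'' x + (1 - l) * Q x)"
    using eq_L2_trans[OF eq_L2_trans[OF eq_L2_sym[OF shift_op_rep(2)[OF assms(1) P]] eq]
        shift_op_rep(2)[OF assms(1) Q]] .
  then have hom: "eq_L2 h (\<lambda>x. 1 * P'' x + -1 * Q'' x + w\<^sup>2 * (1 * P x + -1 * Q x)) (\<lambda>x. 0)"
    unfolding eq_L2_def by eventually_elim (simp add: assms(2) algebra_simps)
  have sol: "P x - Q x = (P 0 - Q 0) * cos_sol w x" if "0 \<le> x" "x \<le> h" for x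
    using homogeneous_solution[OF assms(1) R hom that] by simp
  have "P 0 - Q 0 = 0"
    using sol[of h] assms P Q by (simp add: dom_rep_def)
  then have "P x = Q x" if "0 < x" "x < h" for x
    using sol[of x] that by simp
  then have "eq_L2 h P Q" by (rule eq_L2_I)
  then show "eq_L2 h p q"
    using P Q eq_L2_trans[OF eq_L2_trans[of h p P Q] eq_L2_sym[of h q Q]] unfolding dom_rep_def by simp
next
  fix f assume f: "f \<in> L2 h"
  obtain Q Q' where Q: "dom_rep h Q Q Q' (\<lambda>x. f x - w\<^sup>2 * Q x)"
    using boundary_value_problem_solvable[OF assms(1) f assms(3)] .
  have "eq_L2 h (shift_op (op_L h) l Q) f"
    using shift_op_rep(2)[OF assms(1) Q, of l] by (simp add: assms(2))
  then show "\<exists>p\<in>dom_L h. eq_L2 h (shift_op (op_L h) l p) f"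
    using dom_rep_weak_deriv(1)[OF assms(1) Q] by blast
next
  let ?C = "cos_sol w" and ?S = "sin_sol w"
  obtain K1 where K1: "K1 > 0" "\<And>x. x \<in> {0..h} \<Longrightarrow> cmod (?C x) \<le> K1"
    using continuous_on_Icc_bounded[OF cos_sol_continuous] by blast
  obtain K2 where K2: "K2 > 0" "\<And>x. x \<in> {0..h} \<Longrightarrow> cmod (?S x) \<le> K2"
    using continuous_on_Icc_bounded[OF sin_sol_continuous] by blast
  define M where "M = K1 * (2 * K1 * K2 / cmod (?C h)) + 2 * K1 * K2"
  have "M \<ge> 0" using K1 K2 by (simp add: M_def)
  show "\<exists>c. \<forall>p\<in>dom_L h. norm_L2 h p \<le> c * norm_L2 h (shift_op (op_L h) l p)"
  proof (intro exI ballI)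
    fix p assume "p \<in> dom_L h"
    then obtain P P' P'' where P: "dom_rep h p P P' P''" using dom_L_imp_rep[OF assms(1)] by blast
    define f where "f x = P'' x + w\<^sup>2 * P x" for x
    have f: "f \<in> L2 h" "eq_L2 h (shift_op (op_L h) l p) f"
      using shift_op_rep[OF assms(1) P, of l] by (simp_all add: f_def[abs_def] assms(2))
    define N where "N = integral {0..h} (\<lambda>t. cmod (f t))"
    define U where "U x = ?S x * integral {0..x} (\<lambda>t. f t * ?C t) - ?C x * integral {0..x} (\<lambda>t. f t * ?S t)" for x
    have U: "cmod (U x) \<le> 2 * K1 * K2 * N" if "0 \<le> x" "x \<le> h" for x
    proof -
      have "cmod (U x) \<le> cmod (?S x) * cmod (integral {0..x} (\<lambda>t. f t * ?C t))
          + cmod (?C x) * cmod (integral {0..x} (\<lambda>t. f t * ?S t))"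
        unfolding U_def norm_mult[symmetric] by (rule norm_triangle_ineq4)
      also have "\<dots> \<le> K2 * (K1 * N) + K1 * (K2 * N)"
        unfolding N_def using that K1 K2
        by (intro add_mono mult_mono norm_integral_mult_le[OF f(1)] cos_sol_continuous sin_sol_continuous) auto
      finally show ?thesis by (simp add: algebra_simps)
    qed
    have rep: "P x = P 0 * ?C x + U x" if "0 \<le> x" "x \<le> h" for x
      using variation_of_constants[of h P P' P'' x w] that P by (simp add: dom_rep_def f_def U_def)
    have "P 0 = - U h / ?C h"
    proof -
      have "P h = 0" using P by (simp add: dom_rep_def)
      then have "P 0 * ?C h + U h = 0" using rep[of h] assms(1) by simp
      then have "P 0 * ?C h = - U h" by (simp add: eq_neg_iff_add_eq_0)
      then show ?thesis using assms(3) by (metis nonzero_eq_divide_eq)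
    qed
    then have P0: "cmod (P 0) \<le> 2 * K1 * K2 * N / cmod (?C h)"
      using U[of h] assms by (simp add: norm_divide divide_right_mono)
    have sup: "cmod (P x) \<le> M * N" if x: "0 \<le> x" "x \<le> h" for x
    proof -
      have "cmod (P x) \<le> cmod (P 0) * cmod (?C x) + cmod (U x)"
        using norm_triangle_ineq[of "P 0 * ?C x" "U x"] rep[OF x] by (simp add: norm_mult)
      also have "\<dots> \<le> (2 * K1 * K2 * N / cmod (?C h)) * K1 + 2 * K1 * K2 * N"
        using x K1(2)[of x] U[OF x] P0
        by (intro add_mono mult_mono) (auto intro: order_trans[OF norm_ge_zero])
      finally show ?thesis by (simp add: M_def algebra_simps)
    qed
    have N: "N \<le> sqrt h * norm_L2 h f" "N \<ge> 0"
      using L1_le_norm_L2[OF assms(1) f(1)] L2_imp_absolutely_integrable[OF f(1)]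
      by (auto simp: N_def absolutely_integrable_on_def intro!: Henstock_Kurzweil_Integration.integral_nonneg)
    have m: "P \<in> borel_measurable (lebesgue_on {0<..<h})"
      by (rule continuous_measurable_Ioo[OF dom_rep_continuous(1)[OF P]])
    have "norm_L2 h p = norm_L2 h P"
      using P m by (intro norm_L2_cong) (auto simp: dom_rep_def L2_measurable)
    also have "\<dots> \<le> sqrt h * (M * N)"
      using sup m \<open>M \<ge> 0\<close> N(2) assms(1) by (intro norm_L2_le_sup AE_Ioo_I) auto
    also have "\<dots> \<le> sqrt h * (M * (sqrt h * norm_L2 h f))"
      using N \<open>M \<ge> 0\<close> assms(1) by (intro mult_left_mono) auto
    also have "norm_L2 h f = norm_L2 h (shift_op (op_L h) l p)"
      using f shift_op_rep(1)[OF assms(1) P] by (intro norm_L2_cong) (auto simp: L2_measurable eq_L2_sym)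
    finally show "norm_L2 h p \<le> (sqrt h * M * sqrt h) * norm_L2 h (shift_op (op_L h) l p)"
      by (simp add: mult.assoc)
  qed
qed

lemma dom_rep_multiple_cos_sol:
  assumes "cos_sol w h = 0" "p \<in> L2 h" "eq_L2 h p (\<lambda>x. c * cos_sol w x)"
  shows "dom_rep h p (\<lambda>x. c * cos_sol w x) (\<lambda>x. c * (- (w\<^sup>2) * sin_sol w x)) (\<lambda>x. (- c * w\<^sup>2) * cos_sol w x)"
proof -
  have acC: "has_ac_deriv h (cos_sol w) (\<lambda>x. - (w\<^sup>2) * sin_sol w x)" and acS: "has_ac_deriv h (sin_sol w) (cos_sol w)"
    by (intro has_ac_deriv_C1 cos_sol_deriv sin_sol_deriv continuous_intros cos_sol_continuous sin_sol_continuous)+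
  show ?thesis
    unfolding dom_rep_def
    using has_ac_deriv_lincomb[OF acC acC, of c 0] has_ac_deriv_lincomb[OF acS acS, of "- c * w\<^sup>2" 0] assms
    by (auto simp: mult.assoc intro!: continuous_imp_L2 continuous_intros cos_sol_continuous)
qed

lemma cos_sol_in_L2: "cos_sol w \<in> L2 h"
  by (rule continuous_imp_L2[OF cos_sol_continuous])

lemma shift_op_multiple_cos_sol:
  assumes "h > 0" "w\<^sup>2 = 1 - l" "cos_sol w h = 0" "p \<in> L2 h" "eq_L2 h p (\<lambda>x. c * cos_sol w x)"
  shows "p \<in> dom_L h" "shift_op (op_L h) l p \<in> L2 h" "eq_L2 h (shift_op (op_L h) l p) (\<lambda>x. 0)"
  using dom_rep_weak_deriv(1)[OF assms(1) dom_rep_multiple_cos_sol[OF assms(3,4,5)]]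
    shift_op_rep(1,2)[OF assms(1) dom_rep_multiple_cos_sol[OF assms(3,4,5)], of l] assms(2)
  by (simp_all add: algebra_simps)

lemma eigenfunction_cos_sol:
  assumes "h > 0" "w\<^sup>2 = 1 - l" "cos_sol w h = 0"
  shows "eigenfunction h (dom_L h) (op_L h) l (cos_sol w)"
  unfolding eigenfunction_def
proof (intro conjI)
  note s = shift_op_multiple_cos_sol[OF assms cos_sol_in_L2[of w h], of 1]
  show "cos_sol w \<in> dom_L h" using s(1) by (simp add: eq_L2_refl)
  show "\<not> eq_L2 h (cos_sol w) (\<lambda>x. 0)"
    using eq_L2_continuous_unique[OF assms(1) cos_sol_continuous, of "\<lambda>x. 0" w 0] assms(1)
    by (auto simp: cos_sol_0)
  show "eq_L2 h (op_L h (cos_sol w)) (\<lambda>x. l * cos_sol w x)"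
    using s(3) by (simp add: eq_L2_refl shift_op_def eq_L2_diff_0)
qed

text \<open>
  The integrand is $(1 + (SC)')/2$, and $SC$ vanishes at both ends.
\<close>

lemma integral_cos_sol_square:
  assumes "h > 0" "cos_sol w h = 0"
  shows "integral {0..h} (\<lambda>x. cos_sol w x * cos_sol w x) = of_real h / 2"
proof -
  let ?C = "cos_sol w" and ?S = "sin_sol w"
  have acS: "has_ac_deriv h ?S ?C"
    by (intro has_ac_deriv_C1 sin_sol_deriv cos_sol_continuous)
  have "has_ac_deriv h (\<lambda>x. ?S x * ?C x) (\<lambda>x. ?C x * ?C x + ?S x * (- (w\<^sup>2) * ?S x))"
    by (rule has_ac_deriv_mult_cos_sol[OF acS])
  also have "(\<lambda>x. ?C x * ?C x + ?S x * (- (w\<^sup>2) * ?S x)) = (\<lambda>x. 2 * (?C x * ?C x) - 1)"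
    using cos_sol_sin_sol[of w] by (auto simp: power2_eq_square algebra_simps)
  finally have "integral {0..h} (\<lambda>x. 2 * (?C x * ?C x) - 1) = 0"
    using has_ac_deriv_diff[of h "\<lambda>x. ?S x * ?C x" _ 0 h] assms by auto
  moreover have "(\<lambda>x. ?C x * ?C x) integrable_on {0..h}"
    by (intro integrable_continuous_real continuous_intros cos_sol_continuous)
  then have "integral {0..h} (\<lambda>x. 2 * (?C x * ?C x) - 1) = 2 * integral {0..h} (\<lambda>x. ?C x * ?C x) - of_real h"
    using assms(1) Henstock_Kurzweil_Integration.integral_diff[OF integrable_on_mult_right[of _ _ 2]
        integrable_const_ivl[of "1::complex" 0 h]] by (simp add: scaleR_conv_of_real)
  ultimately show ?thesis by (simp add: mult.commute)
qed

text \<open>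
  No Jordan chain starts: if $p$ is in the domain and $(L - \lambda) p = c\, C$, then the boundary
  condition at $h$ reads $c\, S(h)\, h/2 = 0$. As $S(h) \neq 0$, it forces $c = 0$, so that $p$ is in
  the eigenspace.
\<close>

lemma simple_eigenvalue_cos_sol:
  assumes "h > 0" "w\<^sup>2 = 1 - l" "cos_sol w h = 0"
  shows "simple_eigenvalue h (dom_L h) (op_L h) l"
proof -
  let ?D = "dom_L h" and ?A = "op_L h"
  let ?E = "{p \<in> L2 h. \<exists>c. eq_L2 h p (\<lambda>x. c * cos_sol w x)}"
  have sup: "?E \<subseteq> kernel_power h ?D ?A l (Suc k)" for k
  proof (induction k)
    case 0
    show ?case using shift_op_multiple_cos_sol[OF assms] by auto
  next
    case (Suc k)
    have "shift_op ?A l p \<in> ?E" if "p \<in> ?E" for p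
      using that shift_op_multiple_cos_sol[OF assms, of p] by (auto intro: exI[of _ 0])
    then show ?case using Suc shift_op_multiple_cos_sol(1)[OF assms] by auto
  qed
  have base: "p \<in> ?E" if p: "p \<in> ?D" "eq_L2 h (shift_op ?A l p) (\<lambda>x. 0)" for p
  proof -
    obtain P P' P'' where P: "dom_rep h p P P' P''" using dom_L_imp_rep[OF assms(1) p(1)] .
    have hom: "eq_L2 h (\<lambda>x. P'' x + w\<^sup>2 * P x) (\<lambda>x. 0)"
      using eq_L2_trans[OF eq_L2_sym[OF shift_op_rep(2)[OF assms(1) P]] p(2)] assms(2) by simp
    have "eq_L2 h P (\<lambda>x. P 0 * cos_sol w x)"
      by (intro eq_L2_I homogeneous_solution[OF assms(1) P hom] less_imp_le)
    then show ?thesis using P eq_L2_trans unfolding dom_rep_def by blast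
  qed
  have sub: "kernel_power h ?D ?A l (Suc k) \<subseteq> ?E" for k
  proof (induction k)
    case 0
    show ?case using base by auto
  next
    case (Suc k)
    show ?case
    proof
      fix p assume "p \<in> kernel_power h ?D ?A l (Suc (Suc k))"
      then have p: "p \<in> ?D" "shift_op ?A l p \<in> ?E" using Suc by auto
      then obtain c where c: "eq_L2 h (shift_op ?A l p) (\<lambda>x. c * cos_sol w x)" by blast
      obtain P P' P'' where P: "dom_rep h p P P' P''" using dom_L_imp_rep[OF assms(1) p(1)] .
      have f: "eq_L2 h (\<lambda>x. P'' x + w\<^sup>2 * P x) (\<lambda>x. c * cos_sol w x)"
        using eq_L2_trans[OF eq_L2_sym[OF shift_op_rep(2)[OF assms(1) P]] c] assms(2) by simp
      have "integral {0..h} (\<lambda>x. (P'' x + w\<^sup>2 * P x) * cos_sol w x)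
          = integral {0..h} (\<lambda>x. c * (cos_sol w x * cos_sol w x))"
        using eq_L2_integral[OF eq_L2_mult[OF f, of "cos_sol w"] order_refl] by (simp add: mult.assoc)
      also have "\<dots> = c * (of_real h / 2)"
        by (simp only: Henstock_Kurzweil_Integration.integral_mult_right integral_cos_sol_square[OF assms(1,3)])
      finally have "integral {0..h} (\<lambda>x. (P'' x + w\<^sup>2 * P x) * cos_sol w x) = c * (of_real h / 2)" .
      moreover have "has_ac_deriv h P P'" "has_ac_deriv h P' P''" "P' 0 = 0" "P h = 0"
        using P by (simp_all add: dom_rep_def)
      ultimately have "sin_sol w h * (c * (of_real h / 2)) = 0"
        using variation_of_constants[of h P P' P'' h w] assms(1,3) by auto
      moreover have "sin_sol w h \<noteq> 0"
        using cos_sol_sin_sol[of w h] assms(3) by auto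
      ultimately have "c = 0" using assms(1) by simp
      then show "p \<in> ?E" using base[OF p(1)] c by simp
    qed
  qed
  show ?thesis
    unfolding simple_eigenvalue_def
  proof (intro exI conjI allI impI)
    show "eigenfunction h ?D ?A l (cos_sol w)" by (rule eigenfunction_cos_sol[OF assms])
    show "kernel_power h ?D ?A l k = ?E" if "1 \<le> k" for k
      using sup[of "k - 1"] sub[of "k - 1"] that by (cases k) auto
  qed
qed

lemma in_spectrum_iff:
  assumes "h > 0" "w\<^sup>2 = 1 - l"
  shows "l \<in> spectrum h (dom_L h) (op_L h) \<longleftrightarrow> cos_sol w h = 0"
proof
  assume "l \<in> spectrum h (dom_L h) (op_L h)"
  then show "cos_sol w h = 0" using in_resolvent_set[OF assms] by (auto simp: spectrum_def)
next
  assume c: "cos_sol w h = 0"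
  note s = shift_op_multiple_cos_sol[OF assms c]
  have "cos_sol w \<in> dom_L h" "eq_L2 h (shift_op (op_L h) l (cos_sol w)) (\<lambda>x. 0)"
    using s[OF cos_sol_in_L2[of w h], of 1] by (simp_all add: eq_L2_refl)
  moreover have "(\<lambda>x. 0) \<in> dom_L h" "eq_L2 h (shift_op (op_L h) l (\<lambda>x. 0)) (\<lambda>x. 0)"
    using s[of "\<lambda>x. 0" 0] by (simp_all add: eq_L2_refl continuous_imp_L2)
  moreover have "\<not> eq_L2 h (cos_sol w) (\<lambda>x. 0)"
    using eigenfunction_cos_sol[OF assms c] by (simp add: eigenfunction_def)
  ultimately show "l \<in> spectrum h (dom_L h) (op_L h)"
    unfolding spectrum_def resolvent_set_def using eq_L2_trans eq_L2_sym by blast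
qed

section \<open>The linearization at zero\<close>

lemma dom_rep_zero: "dom_rep h (\<lambda>x. 0) (\<lambda>x. 0) (\<lambda>x. 0) (\<lambda>x. 0)"
  by (simp add: dom_rep_def eq_L2_refl has_ac_deriv_def continuous_imp_L2)

lemma norm_L2_le_norm_H2:
  "norm_L2 h p \<le> norm_H2 h p" "norm_L2 h (weak_deriv h p) \<le> norm_H2 h p"
  "norm_L2 h (weak_deriv h (weak_deriv h p)) \<le> norm_H2 h p"
  by (auto simp: norm_H2_def intro!: real_le_rsqrt)

lemma norm_H2_nonneg: "norm_H2 h p \<ge> 0"
  by (simp add: norm_H2_def)

text \<open>
  Because $P(h) = 0$, the value $P(x)$ is minus the integral of $P'$ over $[x,h]$.
\<close>

lemma dom_L_sup_bound:
  assumes "h > 0" "dom_rep h p P P' P''" "0 \<le> x" "x \<le> h"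
  shows "cmod (P x) \<le> sqrt h * norm_H2 h p"
proof -
  have P: "has_ac_deriv h P P'" "P h = 0" and P'L2: "P' \<in> L2 h"
    using assms(2) continuous_imp_L2[OF dom_rep_continuous(2)[OF assms(2)]] by (auto simp: dom_rep_def)
  have "- P x = integral {x..h} P'"
    using has_ac_deriv_diff[OF P(1) assms(3,4)] P(2) by simp
  then have "cmod (P x) = cmod (integral {x..h} P')" by (metis norm_minus_cancel)
  also have "\<dots> \<le> integral {x..h} (\<lambda>t. cmod (P' t))"
    using assms by (intro integral_norm_bound_integral has_ac_deriv_integrable[OF P(1)]) auto
  also have "\<dots> \<le> integral {0..h} (\<lambda>t. cmod (P' t))"
    using assms by (intro integral_subset_le has_ac_deriv_integrable[OF P(1)]) auto
  also have "\<dots> \<le> sqrt h * norm_L2 h P'"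
    by (rule L1_le_norm_L2[OF assms(1) P'L2])
  also have "norm_L2 h P' = norm_L2 h (weak_deriv h p)"
    using dom_rep_weak_deriv[OF assms(1,2)] P'L2 by (intro norm_L2_cong) (auto simp: L2_measurable eq_L2_sym)
  also have "sqrt h * \<dots> \<le> sqrt h * norm_H2 h p"
    using assms(1) by (intro mult_left_mono norm_L2_le_norm_H2) auto
  finally show ?thesis .
qed

lemma dom_L_sup_bound_AE:
  assumes "h > 0" "p \<in> dom_L h"
  shows "AE x in lebesgue_on {0<..<h}. cmod (p x) \<le> sqrt h * norm_H2 h p"
proof -
  obtain P P' P'' where P: "dom_rep h p P P' P''" using dom_L_imp_rep[OF assms] .
  have "AE x in lebesgue_on {0<..<h}. p x = P x" using P by (simp add: dom_rep_def eq_L2_def)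
  moreover have "AE x in lebesgue_on {0<..<h}. cmod (P x) \<le> sqrt h * norm_H2 h p"
    using dom_L_sup_bound[OF assms(1) P] by (intro AE_Ioo_I) auto
  ultimately show ?thesis by eventually_elim simp
qed

lemma op_L_linear:
  assumes "h > 0" "p \<in> dom_L h" "q \<in> dom_L h"
  shows "(\<lambda>x. a * p x + b * q x) \<in> dom_L h"
    "eq_L2 h (op_L h (\<lambda>x. a * p x + b * q x)) (\<lambda>x. a * op_L h p x + b * op_L h q x)"
proof -
  obtain P P' P'' where P: "dom_rep h p P P' P''" using dom_L_imp_rep[OF assms(1,2)] .
  obtain Q Q' Q'' where Q: "dom_rep h q Q Q' Q''" using dom_L_imp_rep[OF assms(1,3)] .
  note R = dom_rep_lincomb[OF P Q, of a b]
  show "(\<lambda>x. a * p x + b * q x) \<in> dom_L h" by (rule dom_rep_weak_deriv(1)[OF assms(1) R])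
  show "eq_L2 h (op_L h (\<lambda>x. a * p x + b * q x)) (\<lambda>x. a * op_L h p x + b * op_L h q x)"
    using dom_rep_weak_deriv(3)[OF assms(1) R] dom_rep_weak_deriv(3)[OF assms(1) P] dom_rep_weak_deriv(3)[OF assms(1) Q]
    unfolding eq_L2_def op_L_def by eventually_elim (simp add: algebra_simps)
qed

lemma linearization_op_L:
  assumes "h > 0"
  shows "linearization_at_zero h (dom_L h) (op_N h) (op_L h)"
proof -
  let ?W = "\<lambda>p. weak_deriv h (weak_deriv h p)"
  have W: "?W p \<in> L2 h" "p \<in> L2 h" "(\<lambda>x. p x * p x) \<in> L2 h"
    and sq: "norm_L2 h (\<lambda>x. p x * p x) \<le> sqrt h * norm_H2 h p * norm_H2 h p" if "p \<in> dom_L h" for p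
  proof -
    obtain P P' P'' where P: "dom_rep h p P P' P''" using dom_L_imp_rep[OF assms \<open>p \<in> dom_L h\<close>] .
    show 1: "?W p \<in> L2 h" "p \<in> L2 h"
      using dom_rep_weak_deriv(5)[OF assms P] P by (simp_all add: dom_rep_def)
    note b = dom_L_sup_bound_AE[OF assms that]
    show "(\<lambda>x. p x * p x) \<in> L2 h"
      by (rule L2_mult_bounded[OF 1(2) L2_measurable[OF 1(2)] b])
    note nn = norm_H2_nonneg[of h p]
    then have "norm_L2 h (\<lambda>x. p x * p x) \<le> sqrt h * norm_H2 h p * norm_L2 h p"
      using assms by (intro norm_L2_mult_bounded[OF 1(2) L2_measurable[OF 1(2)] _ b]) auto
    also have "\<dots> \<le> sqrt h * norm_H2 h p * norm_H2 h p"
      using nn assms by (intro mult_left_mono norm_L2_le_norm_H2) auto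
    finally show "norm_L2 h (\<lambda>x. p x * p x) \<le> sqrt h * norm_H2 h p * norm_H2 h p" .
  qed
  have zero: "eq_L2 h (?W (\<lambda>x. 0)) (\<lambda>x. 0)"
    by (rule dom_rep_weak_deriv(3)[OF assms dom_rep_zero])
  have L: "op_L h p \<in> L2 h" "norm_L2 h (op_L h p) \<le> 2 * norm_H2 h p" if "p \<in> dom_L h" for p
  proof -
    have eq: "op_L h p = (\<lambda>x. 1 * ?W p x + 1 * p x)" by (simp add: op_L_def)
    show "op_L h p \<in> L2 h" unfolding eq by (intro L2_lincomb W that)
    have "(norm_L2 h (op_L h p))\<^sup>2 \<le> 2 * (norm_L2 h (?W p))\<^sup>2 + 2 * (norm_L2 h p)\<^sup>2"
      unfolding eq using norm_L2_lincomb_le[OF W(1,2)[OF that], of 1 1] by simp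
    also have "\<dots> \<le> 2 * (norm_H2 h p)\<^sup>2 + 2 * (norm_H2 h p)\<^sup>2"
      by (intro add_mono mult_left_mono power_mono norm_L2_le_norm_H2 norm_L2_nonneg) auto
    also have "\<dots> = (2 * norm_H2 h p)\<^sup>2" by (simp add: power_mult_distrib)
    finally show "norm_L2 h (op_L h p) \<le> 2 * norm_H2 h p"
      by (rule power2_le_imp_le) (simp add: norm_H2_nonneg)
  qed
  have N: "op_N h p \<in> L2 h" if "p \<in> dom_L h" for p
  proof -
    have "op_N h p = (\<lambda>x. 1 * op_L h p x + (-1) * (p x * p x))"
      by (auto simp: op_N_def op_L_def algebra_simps)
    then show ?thesis using L2_lincomb[OF L(1)[OF that] W(3)[OF that], of 1 "-1"] by simp
  qed
  have frechet: "norm_L2 h (\<lambda>x. op_N h p x - op_N h (\<lambda>y. 0) x - op_L h p x) \<le> \<epsilon> * norm_H2 h p"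
    if "\<epsilon> > 0" "p \<in> dom_L h" "norm_H2 h p < \<epsilon> / sqrt h" for \<epsilon> p
  proof -
    have z: "(\<lambda>x. 0) \<in> dom_L h" by (rule dom_rep_weak_deriv(1)[OF assms dom_rep_zero])
    have "norm_L2 h (\<lambda>x. op_N h p x - op_N h (\<lambda>y. 0) x - op_L h p x) = norm_L2 h (\<lambda>x. p x * p x)"
    proof -
      have "(norm_L2 h (\<lambda>x. op_N h p x - op_N h (\<lambda>y. 0) x - op_L h p x)) = norm_L2 h (\<lambda>x. - (p x * p x))"
      proof (rule norm_L2_cong)
        show "(\<lambda>x. op_N h p x - op_N h (\<lambda>y. 0) x - op_L h p x) \<in> borel_measurable (lebesgue_on {0<..<h})"
          by (intro L2_measurable L2_diff N L that z)
        show "(\<lambda>x. - (p x * p x)) \<in> borel_measurable (lebesgue_on {0<..<h})"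
          using L2_measurable[OF W(3)[OF that(2)]] by simp
        show "eq_L2 h (\<lambda>x. op_N h p x - op_N h (\<lambda>y. 0) x - op_L h p x) (\<lambda>x. - (p x * p x))"
          using zero unfolding eq_L2_def by eventually_elim (simp add: op_N_def op_L_def algebra_simps)
      qed
      then show ?thesis by (simp add: norm_L2_def)
    qed
    also have "\<dots> \<le> (sqrt h * norm_H2 h p) * norm_H2 h p"
      using sq[OF that(2)] by simp
    also have "\<dots> \<le> \<epsilon> * norm_H2 h p"
    proof (rule mult_right_mono)
      show "sqrt h * norm_H2 h p \<le> \<epsilon>" using that(3) assms by (simp add: field_simps)
    qed (rule norm_H2_nonneg)
    finally show ?thesis .
  qed
  have "eq_L2 h (op_N h (\<lambda>x. 0)) (\<lambda>x. 0)" using zero by (simp add: op_N_def)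
  moreover have "\<forall>\<epsilon>>0. \<exists>\<delta>>0. \<forall>p\<in>dom_L h. norm_H2 h p < \<delta> \<longrightarrow>
      norm_L2 h (\<lambda>x. op_N h p x - op_N h (\<lambda>y. 0) x - op_L h p x) \<le> \<epsilon> * norm_H2 h p"
  proof (intro allI impI)
    fix \<epsilon> :: real assume "\<epsilon> > 0"
    then show "\<exists>\<delta>>0. \<forall>p\<in>dom_L h. norm_H2 h p < \<delta> \<longrightarrow>
        norm_L2 h (\<lambda>x. op_N h p x - op_N h (\<lambda>y. 0) x - op_L h p x) \<le> \<epsilon> * norm_H2 h p"
      \<comment> \<open>The remainder is at most $\sqrt{h}$ times the square of the $H^2$ norm.\<close>
      using frechet assms by (intro exI[of _ "\<epsilon> / sqrt h"]) auto
  qed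
  ultimately show ?thesis
    unfolding linearization_at_zero_def
    using dom_rep_weak_deriv(1)[OF assms dom_rep_zero] N L op_L_linear[OF assms]
    by (intro conjI ballI allI exI[of _ 2]) simp_all
qed

section \<open>The list of eigenvalues and the stability threshold\<close>

definition wavenumber :: "real \<Rightarrow> nat \<Rightarrow> real" where
  "wavenumber h n = (real n - 1/2) * pi / h"

lemma wavenumber_square: "(complex_of_real (wavenumber h n))\<^sup>2 = 1 - complex_of_real (eigval h n)"
proof -
  have "(wavenumber h n)\<^sup>2 = 1 - eigval h n"
    by (simp add: wavenumber_def eigval_def power_divide power_mult_distrib)
  then show ?thesis by (metis of_real_1 of_real_diff of_real_power)
qed

lemma cos_sol_wavenumber:
  assumes "h > 0"
  shows "cos_sol (of_real (wavenumber h n)) = eigfun h n"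
proof
  fix x
  have "wavenumber h n * x = (2 * real n - 1) * pi * x / (2 * h)"
    using assms by (simp add: wavenumber_def field_simps)
  then show "cos_sol (of_real (wavenumber h n)) x = eigfun h n x"
    by (simp add: cos_sol_def eigfun_def flip: of_real_mult cos_of_real)
qed

lemma cos_sol_boundary_iff:
  assumes "h > 0" "w\<^sup>2 = 1 - l"
  shows "cos_sol w h = 0 \<longleftrightarrow> (\<exists>n\<ge>1. l = complex_of_real (eigval h n))"
proof
  assume "cos_sol w h = 0"
  then obtain m :: int where m: "w * of_real h = complex_of_real (of_int m * pi) + of_real pi / 2"
    by (auto simp: cos_sol_def cos_eq_0)
  \<comment> \<open>The zeros $m + 1/2$ and $-(m + 1/2)$ of the cosine belong to the same eigenvalue.\<close>
  define n where "n = (if m \<ge> 0 then nat (m + 1) else nat (- m))"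
  have n: "n \<ge> 1" "(real n - 1/2)\<^sup>2 = (real_of_int m + 1/2)\<^sup>2"
    by (auto simp: n_def power2_eq_square algebra_simps)
  have "w = complex_of_real ((of_int m + 1/2) * pi / h)"
    using m assms(1) by (simp add: field_simps)
  then have "w\<^sup>2 = complex_of_real (((of_int m + 1/2) * pi / h)\<^sup>2)"
    by simp
  also have "((of_int m + 1/2) * pi / h)\<^sup>2 = 1 - eigval h n"
    using n(2) by (simp add: eigval_def power_divide power_mult_distrib)
  finally have "l = complex_of_real (eigval h n)" using assms(2) by simp
  then show "\<exists>n\<ge>1. l = complex_of_real (eigval h n)" using n(1) by blast
next
  assume "\<exists>n\<ge>1. l = complex_of_real (eigval h n)"
  then obtain n where n: "n \<ge> 1" "l = complex_of_real (eigval h n)" by blast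
  have "w\<^sup>2 = (complex_of_real (wavenumber h n))\<^sup>2"
    using assms(2) n(2) by (simp add: wavenumber_square)
  then have "w = of_real (wavenumber h n) \<or> w = - of_real (wavenumber h n)"
    by (simp add: power2_eq_iff)
  then have "cos_sol w h = cos_sol (of_real (wavenumber h n)) h"
    by (auto simp: cos_sol_def)
  also have "\<dots> = 0"
  proof -
    have "complex_of_real (wavenumber h n) * of_real h = complex_of_real (of_int (int n - 1) * pi) + of_real pi / 2"
      using assms(1) by (simp add: wavenumber_def field_simps)
    then show ?thesis unfolding cos_sol_def cos_eq_0 by blast
  qed
  finally show "cos_sol w h = 0" .
qed

lemma spectrum_op_L:
  assumes "h > 0"
  shows "spectrum h (dom_L h) (op_L h) = {complex_of_real (eigval h n) | n. n \<ge> 1}"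
proof (rule set_eqI)
  fix l
  have "(csqrt (1 - l))\<^sup>2 = 1 - l" by simp
  then show "l \<in> spectrum h (dom_L h) (op_L h) \<longleftrightarrow> l \<in> {complex_of_real (eigval h n) | n. n \<ge> 1}"
    using in_spectrum_iff[OF assms] cos_sol_boundary_iff[OF assms] by fast
qed

lemma eigval_pos_iff:
  assumes "h > 0"
  shows "(\<exists>n\<ge>1. eigval h n > 0) \<longleftrightarrow> h > pi / 2"
proof
  assume "\<exists>n\<ge>1. eigval h n > 0"
  then obtain n where n: "n \<ge> 1" "eigval h n > 0" by blast
  have "((real n - 1/2) * pi)\<^sup>2 < h\<^sup>2"
    using n(2) assms unfolding eigval_def power_mult_distrib by (simp add: divide_less_eq)
  then have "(real n - 1/2) * pi < h"
    using assms by (simp add: power2_less_imp_less)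
  moreover have "pi / 2 \<le> (real n - 1/2) * pi"
    using n(1) mult_right_mono[of "1/2" "real n - 1/2" pi] by simp
  ultimately show "h > pi / 2" by (rule order_le_less_trans[rotated])
next
  assume "h > pi / 2"
  then have "(pi / 2)\<^sup>2 < h\<^sup>2" by (intro power_strict_mono) auto
  then have "eigval h 1 > 0"
    using assms by (simp add: eigval_def power_divide field_simps)
  then show "\<exists>n\<ge>1. eigval h n > 0" by blast
qed

theorem mainTheorem3:
  fixes h :: real
  assumes "h > 0"
  shows "linearization_at_zero h (dom_L h) (op_N h) (op_L h) \<and>
    spectrum h (dom_L h) (op_L h) = {complex_of_real (eigval h n) | n. n \<ge> 1} \<and>
    (\<forall>n\<ge>1. simple_eigenvalue h (dom_L h) (op_L h) (complex_of_real (eigval h n)) \<and>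
            eigenfunction h (dom_L h) (op_L h) (complex_of_real (eigval h n)) (eigfun h n)) \<and>
    (h \<le> pi / 2 \<longrightarrow> spectrally_stable h (dom_L h) (op_L h)) \<and>
    (h > pi / 2 \<longrightarrow> spectrally_unstable h (dom_L h) (op_L h))"
proof (intro conjI)
  show "linearization_at_zero h (dom_L h) (op_N h) (op_L h)"
    by (rule linearization_op_L[OF assms])
  show spec: "spectrum h (dom_L h) (op_L h) = {complex_of_real (eigval h n) | n. n \<ge> 1}"
    by (rule spectrum_op_L[OF assms])
  have "cos_sol (of_real (wavenumber h n)) h = 0" if "n \<ge> 1" for n
    using cos_sol_boundary_iff[OF assms wavenumber_square] that by blast
  then show "\<forall>n\<ge>1. simple_eigenvalue h (dom_L h) (op_L h) (complex_of_real (eigval h n)) \<and>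
      eigenfunction h (dom_L h) (op_L h) (complex_of_real (eigval h n)) (eigfun h n)"
    using simple_eigenvalue_cos_sol[OF assms wavenumber_square]
      eigenfunction_cos_sol[OF assms wavenumber_square] cos_sol_wavenumber[OF assms] by metis
  have stable_iff: "spectrally_stable h (dom_L h) (op_L h) \<longleftrightarrow> \<not> h > pi / 2"
    unfolding spectrally_stable_def spec eigval_pos_iff[OF assms, symmetric] by auto
  then show "h \<le> pi / 2 \<longrightarrow> spectrally_stable h (dom_L h) (op_L h)"
    and "h > pi / 2 \<longrightarrow> spectrally_unstable h (dom_L h) (op_L h)"
    by (auto simp: spectrally_unstable_def)
qed

end
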